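(* Let $f_1,f_2:\mathbb{N}\to\mathbb{C}$ be multiplicative functions such that, for $i=1,2$, there is a positive integer $M_i$ for which $f_i$ satisfies the following three conditions with $M=M_i$: (i) for some prime $q\mid M$, $\sum_{k=0}^\infty \frac{f_i(q^k)}{q^k}=0$; (ii) for each prime power $p^a\,\|\,M$, $f_i(p^k)=f_i(p^a)$ for all $k\geq a$; (iii) for each prime $p$ with $\gcd(p,M)=1$, $f_i(p^k)=1$ for all $k\geq 1$. Then $$\sum_{n\leq x}(f_1\ast f_2)(n)=\Omega(x^{1/4}),$$ that is, $\limsup_{x\to\infty} x^{-1/4}\left|\sum_{n\leq x}(f_1\ast f_2)(n)\right|>0$.
   Context: $(f_1\ast f_2)(n)=\sum_{d\mid n}f_1(d)f_2(n/d)$ denotes Dirichlet convolution. $p^a\,\|\,M$ means $p^a\mid M$ and $p^{a+1}\nmid M$. A multiplicative function satisfying (i)–(iii) for $M$ is $M$-periodic. *)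

theory Defs
  imports "HOL-Analysis.Analysis"
begin

text \<open>Arithmetic functions are modelled as functions on \<^typ>\<open>nat\<close>; only their values at positive
  arguments matter below, and the value at 0 is left unconstrained.\<close>

definition multiplicative_fun :: "(nat \<Rightarrow> complex) \<Rightarrow> bool" where
  "multiplicative_fun f \<longleftrightarrow>
     f 1 = 1 \<and> (\<forall>m n. m > 0 \<longrightarrow> n > 0 \<longrightarrow> coprime m n \<longrightarrow> f (m * n) = f m * f n)"

definition dirichlet_conv :: "(nat \<Rightarrow> complex) \<Rightarrow> (nat \<Rightarrow> complex) \<Rightarrow> nat \<Rightarrow> complex" where
  "dirichlet_conv f g n = (\<Sum>d | d dvd n. f d * g (n div d))"

definition exactly_divides_power :: "nat \<Rightarrow> nat \<Rightarrow> nat \<Rightarrow> bool" where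
  "exactly_divides_power p a M \<longleftrightarrow> p ^ a dvd M \<and> \<not> p ^ (a + 1) dvd M"

text \<open>In the first condition, \<open>sums\<close> asserts both convergence of the series and that its value
  is 0. The prime powers in the second condition have exponent at least 1.\<close>

definition periodicity_conditions :: "(nat \<Rightarrow> complex) \<Rightarrow> nat \<Rightarrow> bool" where
  "periodicity_conditions f M \<longleftrightarrow>
     (\<exists>q. prime q \<and> q dvd M \<and> (\<lambda>k. f (q ^ k) / of_nat (q ^ k)) sums 0) \<and>
     (\<forall>p a. prime p \<longrightarrow> a \<ge> 1 \<longrightarrow> exactly_divides_power p a M \<longrightarrow>
        (\<forall>k\<ge>a. f (p ^ k) = f (p ^ a))) \<and>
     (\<forall>p. prime p \<longrightarrow> coprime p M \<longrightarrow> (\<forall>k\<ge>1. f (p ^ k) = 1))"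

end

theory Submission
  imports Defs "HOL-Probability.Probability" "HOL-Real_Asymp.Real_Asymp"
begin

text \<open>
  Write \<open>h = f\<^sub>1 * f\<^sub>2\<close>. Each \<open>f\<^sub>i\<close> is the divisor sum of some \<open>g\<^sub>i\<close> supported on the divisors of \<open>M\<^sub>i\<close>,
  so \<open>h\<close> is a finite combination of dilates of the divisor function. The sum of \<open>h(n)\<close> is
  tested against \<open>k(n) = 2 K\<^sub>0(2 z \<surd>n)\<close>, where \<open>Re z > 0\<close>. The representation
  \<open>2 K\<^sub>0(2 z \<surd>(a b)) = \<integral> exp (- z (a e\<^sup>u + b e\<^sup>-\<^sup>u)) du\<close> factorises in \<open>a\<close> and \<open>b\<close>, so that summing over
  both gives \<open>\<theta>(z) = \<integral> B(z e\<^sup>u) B(z e\<^sup>-\<^sup>u) du\<close> with \<open>B(w) = 1 / (e\<^sup>w - 1)\<close>. When \<open>z\<close> tends to a point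
  \<open>2 \<pi> \<i> y\<close> from the right, with \<open>0 < y \<le> 1\<close>, two poles of the integrand pinch the line of
  integration only if \<open>y = 1\<close>; there \<open>\<theta>\<close> has exactly the growth of a simple pole, and for \<open>y < 1\<close> it
  grows more slowly.

  Let \<open>d\<^sub>i\<close> be the largest element of the support of \<open>g\<^sub>i\<close> and let \<open>z\<close> tend to \<open>2 \<pi> \<i> / \<surd>(d\<^sub>1 d\<^sub>2)\<close>.
  Then only the dilate by \<open>d\<^sub>1 d\<^sub>2\<close> is singular, so the sum of \<open>h(n) k(n)\<close> is of exact order
  \<open>1 / Re z\<close>. On the other hand the differences of \<open>k\<close> are
  \<open>O(n\<^sup>-\<^sup>3\<^sup>/\<^sup>4 exp (- 2 Re z \<surd>n))\<close>, so if the partial sums of \<open>h\<close> were \<open>o(n\<^sup>1\<^sup>/\<^sup>4)\<close>, summation by parts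
  would bound this sum by \<open>o(1 / Re z)\<close>.
\<close>

section \<open>Divisor sum expansion of periodic multiplicative functions\<close>

lemma gcd_mult_coprime:
  fixes a b c :: nat
  assumes "coprime a b"
  shows "gcd (a * b) c = gcd a c * gcd b c"
proof (rule dvd_antisym)
  have "coprime (gcd a c) (gcd b c)"
    using assms by (meson coprime_divisors gcd_dvd1)
  then show "gcd a c * gcd b c dvd gcd (a * b) c"
    by (intro gcd_greatest divides_mult mult_dvd_mono) (auto intro: dvd_mult dvd_mult2)
  show "gcd (a * b) c dvd gcd a c * gcd b c"
  proof -
    have "gcd (a * b) c dvd gcd a c * b" "gcd (a * b) c dvd gcd a c * c"
      by (metis dvd_mult gcd_dvd1 gcd_dvd2 gcd_greatest gcd_mult_distrib_nat mult.commute dvd_mult2)+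
    then show ?thesis
      by (metis gcd_greatest gcd_mult_distrib_nat)
  qed
qed

text \<open>Strong induction, stripping a full prime power \<open>p ^ k\<close> from
  \<open>n\<close>. If \<open>p\<close> divides \<open>M\<close> exactly to the power
  \<open>a\<close>, condition (ii) makes \<open>f (p ^ k)\<close> depend only on
  \<open>min k a\<close>; otherwise (iii) gives 1. Both agree with the value at
  \<open>gcd (p ^ k) M\<close>, and gcds with \<open>M\<close> multiply over coprime
  factors.\<close>

lemma multiplicative_fun_eq_gcd:
  assumes mult: "multiplicative_fun f" and per: "periodicity_conditions f M" and "M > 0" "n > 0"
  shows "f n = f (gcd n M)"
  using \<open>n > 0\<close>
proof (induction n rule: less_induct)
  case (less n)
  have f1: "f 1 = 1" and fm: "\<And>m n. m > 0 \<Longrightarrow> n > 0 \<Longrightarrow> coprime m n \<Longrightarrow> f (m * n) = f m * f n"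
    using mult by (auto simp: multiplicative_fun_def)
  show ?case
  proof (cases "n = 1")
    case False
    then obtain p where p: "prime p" "p dvd n"
      using prime_factor_nat by blast
    define k where "k = multiplicity p n"
    obtain m where m: "n = p ^ k * m" "\<not> p dvd m"
      using multiplicity_decompose'[of n p] p less.prems unfolding k_def
      by (metis not_prime_unit less_numeral_extra(3))
    have "k \<ge> 1"
      using p less.prems unfolding k_def by (simp add: Suc_le_eq prime_multiplicity_gt_zero_iff)
    have m0: "m > 0" using m less.prems by (cases m) auto
    have pk: "p ^ k > 1" using p \<open>k \<ge> 1\<close> by (metis One_nat_def less_eq_Suc_le one_less_power prime_gt_1_nat)
    have cop: "coprime (p ^ k) m"
      using p m by (simp add: prime_imp_coprime)
    have "m < n" using m m0 pk by simp
    have fpk: "f (p ^ k) = f (gcd (p ^ k) M)"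
    proof (cases "p dvd M")
      case False
      then have "coprime p M" using p by (simp add: prime_imp_coprime)
      then have "f (p ^ k) = 1"
        using per p \<open>k \<ge> 1\<close> unfolding periodicity_conditions_def by (elim conjE) (rule allE, assumption, blast)
      moreover have "gcd (p ^ k) M = 1" using \<open>coprime p M\<close> by simp
      ultimately show ?thesis using f1 by simp
    next
      case True
      define a where "a = multiplicity p M"
      have a1: "a \<ge> 1" using True p \<open>M > 0\<close> unfolding a_def
        by (simp add: Suc_le_eq prime_multiplicity_gt_zero_iff)
      obtain M' where M': "M = p ^ a * M'" "\<not> p dvd M'"
        using multiplicity_decompose'[of M p] p \<open>M > 0\<close> unfolding a_def
        by (metis not_prime_unit less_numeral_extra(3))
      have ex: "exactly_divides_power p a M"
        unfolding exactly_divides_power_def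
      proof
        show "p ^ a dvd M" unfolding a_def by (rule multiplicity_dvd)
        show "\<not> p ^ (a + 1) dvd M"
        proof
          assume "p ^ (a + 1) dvd M"
          then have "a + 1 \<le> multiplicity p M"
            by (intro multiplicity_geI) (use p \<open>M > 0\<close> not_prime_unit in auto)
          then show False by (simp add: a_def)
        qed
      qed
      have st: "f (p ^ j) = f (p ^ a)" if "j \<ge> a" for j
      proof -
        have "\<forall>p a. prime p \<longrightarrow> a \<ge> 1 \<longrightarrow> exactly_divides_power p a M \<longrightarrow>
           (\<forall>k\<ge>a. f (p ^ k) = f (p ^ a))"
          using per unfolding periodicity_conditions_def by (elim conjE)
        from this[rule_format, OF p(1) a1 ex that] show ?thesis .
      qed
      have "gcd (p ^ k) M = gcd (p ^ k) (p ^ a)"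
        using p M' by (metis coprime_commute coprime_power_left_iff gcd_mult_right_right_cancel prime_imp_coprime)
      also have "\<dots> = p ^ min k a"
        by (cases "k \<le> a") (simp_all add: min_def gcd_nat.absorb1 gcd_nat.absorb2 le_imp_power_dvd)
      finally show ?thesis
        using st[of k] by (cases "k \<le> a") (simp_all add: min_def)
    qed
    have "f n = f (gcd (p ^ k) M) * f (gcd m M)"
      unfolding m(1) using fm[OF _ m0 cop] pk fpk less.IH[OF \<open>m < n\<close> m0] by (metis gr0I not_one_less_zero)
    also have "\<dots> = f (gcd (p ^ k) M * gcd m M)"
    proof (rule fm[symmetric])
      show "coprime (gcd (p ^ k) M) (gcd m M)"
        using cop by (meson coprime_divisors gcd_dvd1)
    qed (use \<open>M > 0\<close> in auto)
    finally show ?thesis unfolding m(1) gcd_mult_coprime[OF cop] .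
  next
    case True
    show ?thesis unfolding True by simp
  qed
qed

text \<open>Moebius inversion by recursion: the equation at \<open>n\<close> expresses
  \<open>g n\<close> through the values of \<open>g\<close> at proper divisors, so \<open>g\<close>
  is a fixed point of the functional \<open>F\<close> along the well-founded order
  \<open><\<close>.\<close>

lemma ex_divisor_sum:
  fixes f :: "nat \<Rightarrow> complex"
  shows "\<exists>g. \<forall>n>0. f n = (\<Sum>d | d dvd n. g d)"
proof -
  define F where "F = (\<lambda>g n. f n - (\<Sum>d | d dvd n \<and> d \<noteq> n. g d))"
  define R where "R = {(d, n :: nat). d < n}"
  define g where "g = wfrec R F"
  have "adm_wf R F"
    unfolding adm_wf_def
  proof (intro allI impI)
    fix u v :: "nat \<Rightarrow> complex" and n :: nat
    assume *: "\<forall>z. (z, n) \<in> R \<longrightarrow> u z = v z"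
    show "F u n = F v n"
    proof (cases "n = 0")
      case True
      \<comment> \<open>every \<open>d\<close> divides 0, and the sum over an infinite set is 0\<close>
      have "infinite {d :: nat. d \<noteq> 0}"
        using infinite_Ioi[of "0::nat"] by (simp add: greaterThan_def)
      then show ?thesis using True by (simp add: F_def)
    next
      case False
      then have "(\<Sum>d | d dvd n \<and> d \<noteq> n. u d) = (\<Sum>d | d dvd n \<and> d \<noteq> n. v d)"
        using * by (intro sum.cong) (auto simp: R_def nat_dvd_not_less dest: dvd_imp_le)
      then show ?thesis by (simp add: F_def)
    qed
  qed
  moreover have "wf R" unfolding R_def using wf_less_than by (simp add: less_than_def wf)
  ultimately have g: "g n = F g n" for n
    unfolding g_def by (metis wfrec_fixpoint)
  have "f n = (\<Sum>d | d dvd n. g d)" if "n > 0" for n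
  proof -
    have "{d. d dvd n} = insert n {d. d dvd n \<and> d \<noteq> n}" by auto
    then have "(\<Sum>d | d dvd n. g d) = g n + (\<Sum>d | d dvd n \<and> d \<noteq> n. g d)"
      using that by (subst \<open>{d. d dvd n} = _\<close>, subst sum.insert) auto
    then show ?thesis using g[of n] by (simp add: F_def)
  qed
  then show ?thesis by blast
qed

text \<open>Because \<open>f n = f (gcd n M)\<close>, only divisors of \<open>M\<close> occur.
  Discarding those with \<open>g d = 0\<close> makes the coefficient at the largest element of
  \<open>D\<close> nonzero, which rules out cancellation later; \<open>D\<close> is nonempty since
  \<open>g 1 = f 1 = 1\<close>.\<close>

lemma periodic_divisor_expansion:
  assumes "multiplicative_fun f" "\<exists>M>0. periodicity_conditions f M"
  obtains D and g :: "nat \<Rightarrow> complex" where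
    "finite D" "D \<noteq> {}" "0 \<notin> D" "\<And>d. d \<in> D \<Longrightarrow> g d \<noteq> 0"
    "\<And>n. n > 0 \<Longrightarrow> f n = (\<Sum>d\<in>D. if d dvd n then g d else 0)"
proof -
  obtain M where M: "M > 0" "periodicity_conditions f M" using assms by blast
  obtain g where g: "\<And>n. n > 0 \<Longrightarrow> f n = (\<Sum>d | d dvd n. g d)"
    using ex_divisor_sum[of f] by blast
  define D where "D = {d. d dvd M \<and> g d \<noteq> 0}"
  have fin: "finite D" unfolding D_def using M by simp
  have "f 1 = 1" using assms by (simp add: multiplicative_fun_def)
  then have "g 1 = 1" using g[of 1] by simp
  then have "1 \<in> D" by (simp add: D_def)
  moreover have "0 \<notin> D" using M by (auto simp: D_def)
  moreover have "f n = (\<Sum>d\<in>D. if d dvd n then g d else 0)" if "n > 0" for n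
  proof -
    have "f n = (\<Sum>d | d dvd gcd n M. g d)"
      using multiplicative_fun_eq_gcd[OF assms(1) M(2) M(1) that] g[of "gcd n M"] M by simp
    also have "\<dots> = (\<Sum>d\<in>D. if d dvd n then g d else 0)"
      using M by (intro sum.mono_neutral_cong) (auto simp: D_def)
    finally show ?thesis .
  qed
  moreover have "g d \<noteq> 0" if "d \<in> D" for d using that by (simp add: D_def)
  ultimately show ?thesis using fin by (intro that[of D g]) (assumption | blast)+
qed

section \<open>The Bessel kernel\<close>

text \<open>For \<open>u >= 0\<close> the linear terms of \<open>exp u >= 1 + u + u^2/2\<close> and
  \<open>exp (- u) >= 1 - u\<close> cancel; evenness does the rest. The bound provides Gaussian
  majorants for the kernel.\<close>

lemma cosh_ge_quadratic: "cosh (u::real) \<ge> 1 + u\<^sup>2 / 4"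
proof -
  have *: "cosh u \<ge> 1 + u\<^sup>2 / 4" if "u \<ge> 0" for u :: real
    using exp_lower_Taylor_quadratic[OF that] exp_ge_add_one_self[of "-u"]
    by (simp add: cosh_field_def)
  show ?thesis using *[of u] *[of "-u"] by (cases "u \<ge> 0") simp_all
qed

lemma integrable_gaussian:
  assumes "c > 0"
  shows "integrable lborel (\<lambda>u::real. exp (- (c * u\<^sup>2)))"
proof -
  define s where "s = 1 / sqrt (2 * c)"
  have s: "s > 0" "s\<^sup>2 = 1 / (2 * c)" using assms by (auto simp: s_def power_divide)
  have "integrable lborel (\<lambda>u. sqrt (2 * pi * s\<^sup>2) * normal_density 0 s u)"
    using s by (intro integrable_mult_right integrable_normal_density)
  moreover have "sqrt (2 * pi * s\<^sup>2) * normal_density 0 s u = exp (- (c * u\<^sup>2))" for u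
    using s assms by (simp add: normal_density_def)
  ultimately show ?thesis by simp
qed

lemma lborel_integral_even:
  fixes f :: "real \<Rightarrow> 'a :: {banach, second_countable_topology}"
  assumes "integrable lborel f" "\<And>u. f (- u) = f u"
  shows "integral\<^sup>L lborel f = 2 *\<^sub>R (LINT u:{0..}|lborel. f u)"
proof -
  have int: "set_integrable lborel A f" if "A \<in> sets borel" for A
    using assms(1) that unfolding set_integrable_def by (intro integrable_mult_indicator) auto
  have "integral\<^sup>L lborel f = (LINT u:UNIV|lborel. f u)"
    by (simp add: set_lebesgue_integral_def)
  also have "UNIV = {..<0} \<union> {0::real..}" by auto
  also have "(LINT u:\<dots>|lborel. f u) = (LINT u:{..<0}|lborel. f u) + (LINT u:{0..}|lborel. f u)"
    by (intro set_integral_Un int) auto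
  also have "(LINT u:{..<0}|lborel. f u) = (LINT u:{0<..}|lborel. f u)"
    unfolding set_lebesgue_integral_def
    by (subst lborel_integral_real_affine[of "-1" _ 0])
       (auto simp: assms(2) indicator_def intro!: Bochner_Integration.integral_cong)
  also have "\<dots> = (LINT u:{0..}|lborel. f u)"
    unfolding set_lebesgue_integral_def
    by (intro integral_cong_AE) (use assms(1) AE_lborel_singleton[of 0] in \<open>auto simp: indicator_def\<close>)
  finally show ?thesis by (simp add: scaleR_2)
qed

text \<open>In the usual notation this is \<open>2 K\<^sub>0(2 w)\<close>.\<close>

definition kern :: "complex \<Rightarrow> complex" where
  "kern w = (LINT u|lborel. exp (- (2 * w * of_real (cosh u))))"

lemma borel_measurable_cosh [measurable]: "(cosh :: real \<Rightarrow> real) \<in> borel_measurable borel"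
  by (intro borel_measurable_continuous_onI continuous_intros)

text \<open>Splitting \<open>Re w = c + (Re w - c)\<close> spends the quadratic bound on the first
  part and \<open>cosh u >= 1\<close> on the second. The Gaussian then does not depend on
  \<open>w\<close>, while the full factor \<open>exp (- 2 * Re w)\<close> survives.\<close>

lemma norm_exp_cosh_le:
  assumes "0 \<le> c" "c \<le> Re w"
  shows "norm (exp (- (2 * w * of_real (cosh u)))) \<le> exp (- 2 * Re w) * exp (- (c / 2 * u\<^sup>2))"
proof -
  have "Re w * cosh u = c * cosh u + (Re w - c) * cosh u" by (simp add: algebra_simps)
  moreover have "c * cosh u \<ge> c * (1 + u\<^sup>2 / 4)"
    using assms by (intro mult_left_mono cosh_ge_quadratic)
  moreover have "(Re w - c) * cosh u \<ge> (Re w - c) * 1"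
    using assms cosh_real_ge_1[of u] by (intro mult_left_mono) auto
  ultimately have "Re w * cosh u \<ge> c * (1 + u\<^sup>2 / 4) + (Re w - c) * 1"
    by (metis add_mono)
  then have "- (2 * Re w * cosh u) \<le> - 2 * Re w - c / 2 * u\<^sup>2"
    by (simp add: algebra_simps)
  then show ?thesis
    by (simp add: norm_exp_eq_Re flip: exp_add)
qed

lemma integrable_kern:
  assumes "Re w > 0"
  shows "integrable lborel (\<lambda>u. exp (- (2 * w * of_real (cosh u))))"
proof (rule Bochner_Integration.integrable_bound)
  show "integrable lborel (\<lambda>u. exp (- 2 * Re w) * exp (- (Re w / 2 * u\<^sup>2)))"
    using integrable_gaussian[of "Re w / 2"] assms by (intro integrable_mult_right) auto
qed (use norm_exp_cosh_le[of "Re w" w] assms in auto)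

lemma kern_bound:
  assumes "c > 0"
  obtains C where "C > 0" "\<And>w. Re w \<ge> c \<Longrightarrow> norm (kern w) \<le> C * exp (- 2 * Re w)"
proof -
  define I where "I = (LINT u|lborel. exp (- (c / 2 * u\<^sup>2)))"
  have int: "integrable lborel (\<lambda>u::real. exp (- (c / 2 * u\<^sup>2)))"
    using integrable_gaussian[of "c / 2"] assms by simp
  have "I \<ge> 0" unfolding I_def by (intro Bochner_Integration.integral_nonneg) auto
  have "norm (kern w) \<le> (I + 1) * exp (- 2 * Re w)" if "Re w \<ge> c" for w
  proof -
    have "norm (kern w) \<le> (LINT u|lborel. exp (- 2 * Re w) * exp (- (c / 2 * u\<^sup>2)))"
      unfolding kern_def
    proof (rule Bochner_Integration.integral_norm_bound_integral)
      show "integrable lborel (\<lambda>u. exp (- (2 * w * of_real (cosh u))))"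
        using that assms by (intro integrable_kern) auto
      show "integrable lborel (\<lambda>u::real. exp (- 2 * Re w) * exp (- (c / 2 * u\<^sup>2)))"
        by (intro integrable_mult_right int)
    qed (use that assms in \<open>intro norm_exp_cosh_le, auto\<close>)
    also have "\<dots> = I * exp (- 2 * Re w)" by (simp add: I_def)
    also have "\<dots> \<le> (I + 1) * exp (- 2 * Re w)"
      by (intro mult_right_mono) auto
    finally show ?thesis .
  qed
  with \<open>I \<ge> 0\<close> show ?thesis by (intro that[of "(I + 1)"]) auto
qed

text \<open>The shift by \<open>c\<close> moves the origin to the point where
  \<open>a * exp u = b * exp (- u)\<close>. Both summands have size \<open>sqrt (a * b)\<close>
  there, and the exponent becomes a multiple of \<open>cosh\<close>.\<close>

lemma kern_eq_integral:
  assumes "a > 0" "b > 0"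
  shows "(LINT u|lborel. exp (- (z * of_real (a * exp u + b * exp (- u))))) = kern (z * of_real (sqrt (a * b)))"
proof -
  define c where "c = ln (sqrt b / sqrt a)"
  have ec: "exp c = sqrt b / sqrt a" using assms by (simp add: c_def)
  have "a * exp (c + u) + b * exp (- (c + u)) = 2 * (sqrt (a * b) * cosh u)" for u
  proof -
    have "a * exp (c + u) = sqrt (a * b) * exp u"
      using assms by (simp add: exp_add ec real_sqrt_mult field_simps)
    moreover have "b * exp (- (c + u)) = sqrt (a * b) * exp (- u)"
      using assms by (simp add: exp_add exp_diff exp_minus ec real_sqrt_mult field_simps)
    ultimately show ?thesis by (simp add: cosh_field_def algebra_simps)
  qed
  then show ?thesis
    by (subst lborel_integral_real_affine[of 1 _ c]) (simp_all add: kern_def mult_ac)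
qed

lemma integrable_exp_two_sided:
  assumes "a > 0" "b > 0" "Re z > 0"
  shows "integrable lborel (\<lambda>u. exp (- (z * of_real (a * exp u + b * exp (- u)))))"
proof (rule Bochner_Integration.integrable_bound)
  define m where "m = min a b"
  have m: "0 < m" "m \<le> a" "m \<le> b" using assms by (auto simp: m_def)
  show "integrable lborel (\<lambda>u. exp (- (2 * (z * of_real m) * of_real (cosh u))))"
    using m assms by (intro integrable_kern) auto
  have "2 * m * cosh u \<le> a * exp u + b * exp (- u)" for u
    using m by (simp add: cosh_field_def distrib_left add_mono mult_right_mono)
  then have "Re z * (2 * m * cosh u) \<le> Re z * (a * exp u + b * exp (- u))" for u
    using assms by (intro mult_left_mono) auto
  then show "AE u in lborel. norm (exp (- (z * of_real (a * exp u + b * exp (- u)))))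
      \<le> norm (exp (- (2 * (z * of_real m) * of_real (cosh u))))"
    by (simp add: norm_exp_eq_Re algebra_simps)
qed auto

text \<open>Van der Corput: near the stationary point 0 of the phase the trivial bound is used, and beyond \<open>d\<close>
  one integrates by parts, with \<open>cosh u = coth u sinh u\<close> and \<open>coth\<close> decreasing.\<close>

lemma norm_integral_cosh_exp_cosh_le:
  assumes "Re w > 0" "0 < d" "d \<le> 1" "d \<le> U"
  shows "norm (integral {0..U} (\<lambda>u. of_real (cosh u) * exp (- (2 * w * of_real (cosh u)))))
           \<le> exp (- 2 * Re w) * (2 * d + 2 / (d * norm w))"
proof -
  define E where "E = (\<lambda>u::real. exp (- (2 * w * of_real (cosh u))))"
  have w0: "w \<noteq> 0" "norm w > 0" using assms by auto
  have nE: "norm (E u) \<le> exp (- 2 * Re w)" for u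
    using norm_exp_cosh_le[of 0 w u] assms by (simp add: E_def)
  have contE: "continuous_on A E" for A
    unfolding E_def by (intro continuous_intros)
  have cosh1: "cosh u \<le> 2" if "0 \<le> u" "u \<le> 1" for u :: real
  proof -
    have "cosh u \<le> cosh 1" using that by (subst cosh_real_nonneg_le_iff) auto
    also have "cosh (1::real) \<le> 2" 
    proof -
      have "exp (- 1 :: real) \<le> 1" by simp
      from add_mono[OF exp_le this] show ?thesis unfolding cosh_field_def by simp
    qed
    finally show ?thesis .
  qed
  have near: "norm (integral {0..d} (\<lambda>u. of_real (cosh u) * E u)) \<le> 2 * exp (- 2 * Re w) * (d - 0)"
  proof (rule integral_bound)
    show "continuous_on {0..d} (\<lambda>u. of_real (cosh u) * E u)"
      by (intro continuous_intros contE)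
    fix u assume "u \<in> {0..d}"
    then have "cosh u \<le> 2" using cosh1[of u] assms by auto
    then show "norm (of_real (cosh u) * E u) \<le> 2 * exp (- 2 * Re w)"
      using nE[of u] by (simp add: norm_mult mult_mono)
  qed (use assms in auto)
  \<comment> \<open>\<open>sinh u * E u\<close> is the derivative of \<open>- E u / (2 * w)\<close>.
    Hence \<open>P\<close> is the boundary term of the integration by parts, and \<open>Q\<close>
    collects the derivative of the factor \<open>cosh u / sinh u\<close>.\<close>
  define P where "P = (\<lambda>u::real. - (of_real (cosh u / sinh u) * E u / (2 * w)))"
  define Q where "Q = (\<lambda>u::real. of_real (1 / (sinh u)\<^sup>2) * E u / (2 * w))"
  have P': "(P has_vector_derivative (of_real (cosh u) * E u + Q u)) (at u within A)" if "u > 0" for u A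
  proof -
    have s: "sinh u \<noteq> 0" using that by simp
    have d1: "((\<lambda>u. cosh u / sinh u) has_field_derivative - (1 / (sinh u)\<^sup>2)) (at u within A)"
      using s by (auto intro!: derivative_eq_intros)
         (simp add: cosh_square_eq power2_eq_square[symmetric] field_simps)
    have d2: "((\<lambda>u. of_real (cosh u / sinh u)) has_vector_derivative (of_real (- (1 / (sinh u)\<^sup>2)) :: complex)) (at u within A)"
      by (intro has_vector_derivative_of_real has_real_derivative_iff_has_vector_derivative[THEN iffD1] d1)
    have d3: "(cosh has_field_derivative sinh u) (at u within A)"
      by (auto intro!: derivative_eq_intros)
    have d4: "((\<lambda>u. of_real (cosh u)) has_vector_derivative (of_real (sinh u) :: complex)) (at u within A)"
      by (intro has_vector_derivative_of_real has_real_derivative_iff_has_vector_derivative[THEN iffD1] d3)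
    have "((\<lambda>u. exp (- (2 * w * u))) \<circ> (\<lambda>u. of_real (cosh u)) has_vector_derivative
        (of_real (sinh u) * (- (2 * w) * exp (- (2 * w * of_real (cosh u)))))) (at u within A)"
      by (intro field_vector_diff_chain_within d4) (auto intro!: derivative_eq_intros)
    then have dE: "(E has_vector_derivative (of_real (sinh u) * (- (2 * w) * E u))) (at u within A)"
      by (simp add: E_def o_def)
    have "((\<lambda>u. - (1 / (2 * w)) * (of_real (cosh u / sinh u) * E u)) has_vector_derivative
       - (1 / (2 * w)) * (of_real (cosh u / sinh u) * (of_real (sinh u) * (- (2 * w) * E u))
         + of_real (- (1 / (sinh u)\<^sup>2)) * E u)) (at u within A)"
      by (intro has_vector_derivative_mult_right has_vector_derivative_mult d2 dE)
    moreover have "(\<lambda>u. - (1 / (2 * w)) * (of_real (cosh u / sinh u) * E u)) = P"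
      by (simp add: P_def fun_eq_iff)
    moreover have "- (1 / (2 * w)) * (of_real (cosh u / sinh u) * (of_real (sinh u) * (- (2 * w) * E u))
         + of_real (- (1 / (sinh u)\<^sup>2)) * E u) = of_real (cosh u) * E u + Q u"
    proof -
      have "of_real (cosh u / sinh u) * of_real (sinh u) = (of_real (cosh u) :: complex)"
        using s by (simp add: of_real_divide)
      then have "of_real (cosh u / sinh u) * (of_real (sinh u) * (- (2 * w) * E u))
          = - (2 * w) * (of_real (cosh u) * E u)"
        by (metis (no_types, opaque_lifting) mult.assoc mult.left_commute)
      moreover have "- (1 / (2 * w)) * (- (2 * w) * X + Y) = X - Y / (2 * w)" for X Y
        using w0 by (simp add: field_simps)
      ultimately show ?thesis unfolding Q_def by (simp only:) simp
    qed
    ultimately show ?thesis by (simp only:)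
  qed
  have Qint: "Q integrable_on {d..U}"
    unfolding Q_def using assms w0 by (intro integrable_continuous_interval continuous_intros contE) auto
  have hi: "((\<lambda>u. of_real (cosh u) * E u + Q u) has_integral (P U - P d)) {d..U}"
    using assms by (intro fundamental_theorem_of_calculus P') auto
  have far_eq: "integral {d..U} (\<lambda>u. of_real (cosh u) * E u) = P U - P d - integral {d..U} Q"
    using has_integral_diff[OF hi integrable_integral[OF Qint]] by (simp add: integral_unique)
  have Qb: "norm (integral {d..U} Q) \<le> integral {d..U} (\<lambda>u. exp (- 2 * Re w) / (2 * norm w) * (1 / (sinh u)\<^sup>2))"
  proof (rule integral_norm_bound_integral[OF Qint])
    show "(\<lambda>u. exp (- 2 * Re w) / (2 * norm w) * (1 / (sinh u)\<^sup>2)) integrable_on {d..U}"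
      using assms by (intro integrable_continuous_interval continuous_intros) auto
    show "norm (Q u) \<le> exp (- 2 * Re w) / (2 * norm w) * (1 / (sinh u)\<^sup>2)" for u
      using nE[of u] w0 by (simp add: Q_def norm_mult norm_divide norm_power divide_right_mono field_simps mult_left_mono)
  qed
  have "((\<lambda>u. 1 / (sinh u)\<^sup>2) has_integral ((- (cosh U / sinh U)) - (- (cosh d / sinh d)))) {d..U}"
  proof (rule fundamental_theorem_of_calculus)
    fix u assume "u \<in> {d..U}"
    then have s: "sinh u \<noteq> 0" using assms by simp
    have "((\<lambda>u. - (cosh u / sinh u)) has_field_derivative (1 / (sinh u)\<^sup>2)) (at u within {d..U})"
      using s by (auto intro!: derivative_eq_intros)
         (simp add: cosh_square_eq power2_eq_square[symmetric] field_simps)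
    then show "((\<lambda>u. - (cosh u / sinh u)) has_vector_derivative (1 / (sinh u)\<^sup>2)) (at u within {d..U})"
      by (simp add: has_real_derivative_iff_has_vector_derivative)
  qed (use assms in auto)
  then have "integral {d..U} (\<lambda>u. exp (- 2 * Re w) / (2 * norm w) * (1 / (sinh u)\<^sup>2))
      = exp (- 2 * Re w) / (2 * norm w) * (cosh d / sinh d - cosh U / sinh U)"
    by (intro integral_unique has_integral_mult_right) (simp add: algebra_simps)
  with Qb have Qb': "norm (integral {d..U} Q) \<le> exp (- 2 * Re w) / (2 * norm w) * (cosh d / sinh d - cosh U / sinh U)"
    by simp
  have Pb: "norm (P u) \<le> exp (- 2 * Re w) / (2 * norm w) * (cosh u / sinh u)" if "u > 0" for u
    using nE[of u] w0 that by (simp add: P_def norm_mult norm_divide field_simps mult_left_mono)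
  have coth: "cosh d / sinh d \<le> 2 / d"
  proof -
    have "d \<le> sinh d"
      using real_le_x_sinh[of d] assms by (simp add: sinh_field_def exp_minus)
    then show ?thesis using cosh1[of d] assms by (intro frac_le) auto
  qed
  have "norm (integral {d..U} (\<lambda>u. of_real (cosh u) * E u)) \<le> norm (P U) + norm (P d) + norm (integral {d..U} Q)"
    unfolding far_eq by norm
  also have "\<dots> \<le> exp (- 2 * Re w) / (2 * norm w) * (cosh U / sinh U) + exp (- 2 * Re w) / (2 * norm w) * (cosh d / sinh d)
      + exp (- 2 * Re w) / (2 * norm w) * (cosh d / sinh d - cosh U / sinh U)"
    using assms by (intro add_mono Pb Qb') auto
  \<comment> \<open>The two terms with \<open>cosh U / sinh U\<close> cancel: one bounds
    \<open>P U\<close>, the other is subtracted in the integral of \<open>1 / sinh^2\<close>. This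
    makes the bound independent of \<open>U\<close>.\<close>
  also have "\<dots> = exp (- 2 * Re w) / norm w * (cosh d / sinh d)"
    using w0 by (simp add: field_simps)
  also have "exp (- 2 * Re w) / norm w * (cosh d / sinh d) \<le> exp (- 2 * Re w) / norm w * (2 / d)"
    using coth by (intro mult_left_mono) auto
  finally have far: "norm (integral {d..U} (\<lambda>u. of_real (cosh u) * E u)) \<le> exp (- 2 * Re w) / norm w * (2 / d)" .
  have "integral {0..U} (\<lambda>u. of_real (cosh u) * E u)
      = integral {0..d} (\<lambda>u. of_real (cosh u) * E u) + integral {d..U} (\<lambda>u. of_real (cosh u) * E u)"
    using assms by (intro Henstock_Kurzweil_Integration.integral_combine[symmetric]
       integrable_continuous_interval continuous_intros contE) auto
  then have "norm (integral {0..U} (\<lambda>u. of_real (cosh u) * E u))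
     \<le> 2 * exp (- 2 * Re w) * (d - 0) + exp (- 2 * Re w) / norm w * (2 / d)"
    using norm_triangle_le[OF add_mono[OF near far]] by (simp only:)
  then show ?thesis unfolding E_def by (simp add: algebra_simps)
qed

text \<open>Truncation to \<open>{0..U}\<close> allows differentiation in \<open>w\<close> under an
  integral over a compact range; estimates uniform in \<open>U\<close> pass to \<open>kern\<close>
  through this limit.\<close>

lemma kern_tendsto:
  assumes "Re w > 0"
  shows "((\<lambda>U. 2 * integral {0..U} (\<lambda>u. exp (- (2 * w * of_real (cosh u))))) \<longlongrightarrow> kern w) at_top"
proof -
  define f where "f = (\<lambda>u::real. exp (- (2 * w * of_real (cosh u))))"
  have int: "integrable lborel f" using integrable_kern[OF assms] by (simp add: f_def)
  have sint: "set_integrable lborel A f" if "A \<in> sets borel" for A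
    using int that unfolding set_integrable_def by (intro integrable_mult_indicator) auto
  have "((\<lambda>U. 2 * (LINT u:{0..U}|lborel. f u)) \<longlongrightarrow> 2 * (LINT u:{0..}|lborel. f u)) at_top"
    by (intro tendsto_mult_left tendsto_set_lebesgue_integral_at_top sint) auto
  moreover have "(LINT u:{0..U}|lborel. f u) = integral {0..U} f" for U
    by (intro set_borel_integral_eq_integral sint) auto
  moreover have "2 * (LINT u:{0..}|lborel. f u) = kern w"
    unfolding kern_def using lborel_integral_even[OF int] by (simp add: f_def scaleR_conv_of_real)
  ultimately show ?thesis unfolding f_def by (simp only:)
qed

text \<open>Mean value inequality for the truncated integrals \<open>T U\<close> on the segment from
  \<open>z * r\<close> to \<open>z * s\<close>. The derivative brings down the factor
  \<open>- 2 * cosh u\<close>, and the van der Corput bound for it is largest at \<open>r\<close>,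
  where \<open>Re w\<close> and \<open>norm w\<close> are smallest. The cut \<open>d\<close> stays
  free so that it can be optimised later.\<close>

lemma norm_kern_diff_le:
  assumes z: "Re z > 0" and r: "0 < r" "r \<le> s" and d: "0 < d" "d \<le> 1"
  shows "norm (kern (z * of_real r) - kern (z * of_real s))
           \<le> 8 * exp (- 2 * (Re z * r)) * (d + 1 / (d * (norm z * r))) * (norm z * (s - r))"
proof (rule tendsto_upperbound)
  define T :: "real \<Rightarrow> complex \<Rightarrow> complex" where "T = (\<lambda>U w. integral {0..U} (\<lambda>u. exp (- (2 * w * of_real (cosh u)))))"
  define B where "B = 4 * exp (- 2 * (Re z * r)) * (d + 1 / (d * (norm z * r)))"
  have z0: "norm z > 0" using z by auto
  show "((\<lambda>U. norm (2 * T U (z * of_real r) - 2 * T U (z * of_real s)))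
      \<longlongrightarrow> norm (kern (z * of_real r) - kern (z * of_real s))) at_top"
    unfolding T_def using z r by (intro tendsto_intros kern_tendsto) auto
  have le: "norm (T U (z * of_real r) - T U (z * of_real s)) \<le> B * norm (z * of_real r - z * of_real s)"
    if U: "U \<ge> 1" for U
  proof (rule field_differentiable_bound[where S = "closed_segment (z * of_real r) (z * of_real s)"])
    fix w assume "w \<in> closed_segment (z * of_real r) (z * of_real s)"
    then obtain t where t: "0 \<le> t" "t \<le> 1" "w = (1 - t) *\<^sub>R (z * of_real r) + t *\<^sub>R (z * of_real s)"
      by (auto simp: in_segment)
    define x where "x = (1 - t) * r + t * s"
    have w: "w = z * of_real x" by (simp add: t(3) x_def scaleR_conv_of_real algebra_simps)
    have "x - r = t * (s - r)" by (simp add: x_def algebra_simps)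
    then have x: "x \<ge> r" using t r by (metis diff_ge_0_iff_ge mult_nonneg_nonneg)
    have Rew: "Re w > 0" using w x r z by simp
    show "(T U has_field_derivative
         integral {0..U} (\<lambda>u. - 2 * of_real (cosh u) * exp (- (2 * w * of_real (cosh u)))))
         (at w within closed_segment (z * of_real r) (z * of_real s))"
      unfolding T_def cbox_interval[symmetric]
    proof (rule leibniz_rule_field_derivative)
      show "((\<lambda>w. exp (- (2 * w * of_real (cosh u)))) has_field_derivative
          - 2 * of_real (cosh u) * exp (- (2 * w * of_real (cosh u)))) (at w within A)" for w A and u :: real
        by (auto intro!: derivative_eq_intros)
      show "(\<lambda>u. exp (- (2 * w * of_real (cosh u)))) integrable_on cbox 0 U" for w :: complex
        by (intro integrable_continuous continuous_intros)
      show "continuous_on (closed_segment (z * of_real r) (z * of_real s) \<times> cbox 0 U)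
         (\<lambda>(w, u). - 2 * of_real (cosh u) * exp (- (2 * w * of_real (cosh u))))"
        by (auto simp: case_prod_unfold intro!: continuous_intros)
    qed (use \<open>w \<in> _\<close> in auto)
    have "norm (integral {0..U} (\<lambda>u. - 2 * of_real (cosh u) * exp (- (2 * w * of_real (cosh u)))))
       = 2 * norm (integral {0..U} (\<lambda>u. of_real (cosh u) * exp (- (2 * w * of_real (cosh u)))))"
      by (simp add: mult.assoc norm_mult)
    also have "\<dots> \<le> 2 * (exp (- 2 * Re w) * (2 * d + 2 / (d * norm w)))"
      using Rew d U by (intro mult_left_mono norm_integral_cosh_exp_cosh_le) auto
    also have "\<dots> \<le> 2 * (exp (- 2 * (Re z * r)) * (2 * d + 2 / (d * (norm z * r))))"
    proof (intro mult_left_mono mult_mono add_left_mono divide_left_mono)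
      show "exp (- 2 * Re w) \<le> exp (- 2 * (Re z * r))" using w x z by (simp add: mult_left_mono)
      show "norm z * r \<le> norm w" using w x r by (simp add: norm_mult mult_left_mono)
      show "0 < d * norm w * (d * (norm z * r))" using w x r d z0 by (simp add: norm_mult)
    qed (use d z0 r in auto)
    also have "\<dots> = B" by (simp add: B_def algebra_simps)
    finally show "norm (integral {0..U} (\<lambda>u. - 2 * of_real (cosh u) * exp (- (2 * w * of_real (cosh u))))) \<le> B" .
  qed auto
  have nz: "norm (z * of_real r - z * of_real s) = norm z * (s - r)"
    using r by (simp add: norm_mult flip: right_diff_distrib of_real_diff)
  have "norm (2 * T U (z * of_real r) - 2 * T U (z * of_real s))
      \<le> 8 * exp (- 2 * (Re z * r)) * (d + 1 / (d * (norm z * r))) * (norm z * (s - r))" if "U \<ge> 1" for U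
  proof -
    have "norm (2 * T U (z * of_real r) - 2 * T U (z * of_real s))
        = 2 * norm (T U (z * of_real r) - T U (z * of_real s))"
      by (metis norm_mult norm_numeral right_diff_distrib)
    also have "\<dots> \<le> 2 * (B * norm (z * of_real r - z * of_real s))"
      using le that by simp
    also have "\<dots> = 8 * exp (- 2 * (Re z * r)) * (d + 1 / (d * (norm z * r))) * (norm z * (s - r))"
      unfolding nz B_def by simp
    finally show ?thesis .
  qed
  then show "\<forall>\<^sub>F U in at_top. norm (2 * T U (z * of_real r) - 2 * T U (z * of_real s))
      \<le> 8 * exp (- 2 * (Re z * r)) * (d + 1 / (d * (norm z * r))) * (norm z * (s - r))"
    using eventually_ge_at_top[of 1] by (rule eventually_mono[rotated]) blast
qed auto

section \<open>Summation of the kernel over pairs\<close>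

lemma summable_on_inverse_squares: "(\<lambda>n::nat. 1 / (real n)\<^sup>2) summable_on {0<..}"
proof -
  have "summable (\<lambda>n. 1 / (real n)\<^sup>2)"
    using inverse_power_summable[of 2, where ?'a = real] by (simp add: inverse_eq_divide)
  then have "(\<lambda>n::nat. 1 / (real n)\<^sup>2) summable_on UNIV"
    by (rule summable_nonneg_imp_summable_on) auto
  then show ?thesis by (rule summable_on_subset_banach) auto
qed

lemma summable_on_product_of_squares:
  fixes f :: "nat \<Rightarrow> nat \<Rightarrow> complex"
  assumes "\<And>a b. a > 0 \<Longrightarrow> b > 0 \<Longrightarrow> norm (f a b) \<le> C / (real (a * b))\<^sup>2"
  shows "(\<lambda>(a, b). f a b) summable_on {0<..} \<times> {0<..}"
proof -
  obtain S where S: "((\<lambda>n::nat. 1 / (real n)\<^sup>2) has_sum S) {0<..}"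
    using summable_on_inverse_squares by (auto simp: summable_on_def)
  have "(\<lambda>(a, b). C * (1 / (real a)\<^sup>2 * (1 / (real b)\<^sup>2))) summable_on {0::nat<..} \<times> {0::nat<..}"
  proof (cases "C \<ge> 0")
    case True
    show ?thesis
    proof (rule summable_on_SigmaI)
      show "((\<lambda>b. case (a, b) of (a, b) \<Rightarrow> C * (1 / (real a)\<^sup>2 * (1 / (real b)\<^sup>2))) has_sum
          C * (1 / (real a)\<^sup>2 * S)) {0<..}" for a :: nat
        unfolding prod.case by (intro has_sum_cmult_right S)
      show "(\<lambda>a::nat. C * (1 / (real a)\<^sup>2 * S)) summable_on {0<..}"
        by (intro summable_on_cmult_right summable_on_cmult_left summable_on_inverse_squares)
    qed (use True in auto)
  next
    \<comment> \<open>A negative \<open>C\<close> is contradictory: the hypothesis at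
      \<open>a = b = 1\<close> gives \<open>0 <= C\<close>.\<close>
    case False
    moreover have "norm (f 1 1) \<le> C" using assms[of 1 1] by simp
    ultimately show ?thesis using norm_ge_zero[of "f 1 1"] by linarith
  qed
  then have "(\<lambda>x. norm (case x of (a, b) \<Rightarrow> f a b)) summable_on {0<..} \<times> {0<..}"
    by (rule Infinite_Sum.abs_summable_on_comparison_test') (use assms in \<open>auto simp: power_mult_distrib divide_simps\<close>)
  then show ?thesis by (rule abs_summable_summable)
qed

text \<open>With \<open>x = Re z * sqrt n >= c * sqrt n\<close>, the inequality
  \<open>(x / 2) ^ 4 <= exp (2 * x)\<close> turns exponential decay into \<open>n^-2\<close>, which
  at \<open>n = a * b\<close> is absolutely summable over pairs.\<close>

lemma kern_sqrt_bound:
  assumes "c > 0"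
  obtains C where "C > 0" "\<And>z n. Re z \<ge> c \<Longrightarrow> n > 0 \<Longrightarrow>
     norm (kern (z * of_real (sqrt (real n)))) \<le> C / (real n)\<^sup>2"
proof -
  obtain C where C: "C > 0" "\<And>w. Re w \<ge> c \<Longrightarrow> norm (kern w) \<le> C * exp (- 2 * Re w)"
    using kern_bound[OF assms] by blast
  have "norm (kern (z * of_real (sqrt (real n)))) \<le> (16 * C / c ^ 4) / (real n)\<^sup>2"
    if "Re z \<ge> c" "n > 0" for z n
  proof -
    define x where "x = Re z * sqrt (real n)"
    have "x \<ge> c * sqrt (real n)" unfolding x_def using that by (intro mult_right_mono) auto
    moreover have "c * sqrt (real n) \<ge> c * 1" using that assms by (intro mult_left_mono) auto
    ultimately have x: "x \<ge> c" "x \<ge> c * sqrt (real n)" "x > 0" using assms by linarith+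
    have "c ^ 4 * (real n)\<^sup>2 / 16 = (c * sqrt (real n) / 2) ^ 4"
    proof -
      have "sqrt (real n) ^ 4 = (real n)\<^sup>2"
        by (metis mult_2 numeral_Bit0 of_nat_0_le_iff power_mult real_sqrt_pow2)
      then show ?thesis by (simp add: power_mult_distrib power_divide)
    qed
    also have "\<dots> \<le> (x / 2) ^ 4" using x assms by (intro power_mono) auto
    also have "\<dots> \<le> exp (x / 2) ^ 4"
      using x exp_ge_add_one_self[of "x / 2"] by (intro power_mono) linarith+
    also have "\<dots> = exp (2 * x)" by (simp flip: exp_of_nat_mult)
    finally have e: "exp (2 * x) \<ge> c ^ 4 * (real n)\<^sup>2 / 16" .
    have "norm (kern (z * of_real (sqrt (real n)))) \<le> C * exp (- 2 * x)"
      using C(2)[of "z * of_real (sqrt (real n))"] x by (simp add: x_def)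
    also have "\<dots> = C / exp (2 * x)" by (simp add: exp_minus field_simps)
    also have "\<dots> \<le> C / (c ^ 4 * (real n)\<^sup>2 / 16)"
      using e assms that C by (intro divide_left_mono) auto
    finally show ?thesis by (simp add: mult_ac)
  qed
  with C(1) assms show ?thesis by (intro that[of "16 * C / c ^ 4"]) auto
qed

section \<open>The geometric series \<open>bose\<close> and the exchange of summation and
  integration\<close>

definition bose :: "complex \<Rightarrow> complex" where
  "bose w = 1 / (exp w - 1)"

definition theta :: "complex \<Rightarrow> complex" where
  "theta z = (LINT u|lborel. bose (z * of_real (exp u)) * bose (z * of_real (exp (- u))))"

lemma bose_sums:
  assumes "Re w > 0"
  shows "(\<lambda>n. exp (- (w * of_nat (Suc n)))) sums bose w"
proof -
  have "norm (exp (- w)) < 1" using assms by simp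
  then have "(\<lambda>n. exp (- w) * exp (- w) ^ n) sums (exp (- w) * (1 / (1 - exp (- w))))"
    by (intro sums_mult geometric_sums)
  moreover have "exp (- w) * (1 / (1 - exp (- w))) = bose w"
    by (simp add: bose_def exp_minus divide_simps)
  moreover have "exp (- w) * exp (- w) ^ n = exp (- (w * of_nat (Suc n)))" for n
    by (simp add: algebra_simps flip: exp_of_nat_mult exp_add)
  ultimately show ?thesis by simp
qed

lemma norm_bose_le:
  assumes "Re w > 0"
  shows "norm (bose w) \<le> 1 / (exp (Re w) - 1)"
proof -
  have "exp (Re w) - 1 \<le> norm (exp w - 1)"
    using norm_triangle_ineq2[of "exp w" 1] by simp
  moreover have "exp (Re w) - 1 > 0" using assms by simp
  ultimately show ?thesis unfolding bose_def norm_divide norm_one by (intro divide_left_mono mult_pos_pos) linarith+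
qed

lemma bose_measurable [measurable]: "bose \<in> borel_measurable borel"
  unfolding bose_def by measurable

lemma has_sum_positive_iff_Suc:
  "(f has_sum S) {0::nat<..} \<longleftrightarrow> ((\<lambda>n. f (Suc n)) has_sum S) UNIV"
  by (rule has_sum_reindex_bij_betw[symmetric])
     (auto simp: bij_betw_def image_iff gr0_conv_Suc)

text \<open>Sum and integral are exchanged twice, first over \<open>a\<close> with \<open>b\<close>
  fixed, then over \<open>b\<close>. Both times the integrals of norms are controlled by the same
  objects at the real point \<open>Re z\<close>, where the integrands are positive and the kernel
  bound gives summability.\<close>

lemma
  assumes z: "Re z > 0"
  shows theta_integrable:
      "integrable lborel (\<lambda>u. bose (z * of_real (exp u)) * bose (z * of_real (exp (- u))))"
    and theta_has_sum: "((\<lambda>(a, b). kern (z * of_real (sqrt (real (a * b))))) has_sum theta z) ({0<..} \<times> {0<..})"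
proof -
  define I :: "complex \<Rightarrow> nat \<Rightarrow> nat \<Rightarrow> real \<Rightarrow> complex"
    where "I = (\<lambda>z a b u. exp (- (z * of_real (real a * exp u + real b * exp (- u)))))"
  define k where "k = (\<lambda>z a b. kern (z * of_real (sqrt (real (a * b)))))"
  \<comment> \<open>The integrand after the sum over \<open>a\<close> has been carried out as a
    geometric series.\<close>
  define J where "J = (\<lambda>z b u. bose (z * of_real (exp u)) * exp (- (z * of_real (real b * exp (- u)))))"
  have I_int: "integrable lborel (I z a b)" and I_k: "integral\<^sup>L lborel (I z a b) = k z a b"
    if "a > 0" "b > 0" "Re z > 0" for z a b
    using that integrable_exp_two_sided[of "real a" "real b" z] kern_eq_integral[of "real a" "real b" z]
    by (auto simp: I_def k_def)
  \<comment> \<open>Taking norms replaces \<open>z\<close> by \<open>Re z\<close>, so the integral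
    of a norm is again a kernel value.\<close>
  have norm_I: "of_real (norm (I z a b u)) = I (of_real (Re z)) a b u" for z a b u
  proof -
    have "norm (I z a b u) = exp (- (Re z * (real a * exp u + real b * exp (- u))))"
      unfolding I_def norm_exp_eq_Re by (simp del: of_real_add of_real_mult)
    then show ?thesis unfolding I_def by (simp only: of_real_exp of_real_minus of_real_mult)
  qed
  have summ: "(\<lambda>(b, a). k z a b) summable_on {0<..} \<times> {0<..}" if "Re z > 0" for z
  proof -
    note z = that
    obtain C where "\<And>w n. Re w \<ge> Re z \<Longrightarrow> n > 0 \<Longrightarrow> norm (kern (w * of_real (sqrt (real n)))) \<le> C / (real n)\<^sup>2"
      using kern_sqrt_bound[OF z] by blast
    then show ?thesis unfolding k_def
      by (intro summable_on_product_of_squares[where C = C]) (simp add: mult.commute del: of_nat_mult)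
  qed
  have I_sums: "(\<lambda>n. I z (Suc n) b u) sums J z b u" if "Re z > 0" for z b u
  proof -
    have "(\<lambda>n. exp (- (z * of_real (exp u) * of_nat (Suc n))) * exp (- (z * of_real (real b * exp (- u)))))
        sums J z b u"
      unfolding J_def using that by (intro sums_mult2 bose_sums) simp
    then show ?thesis
      by (simp add: I_def algebra_simps flip: exp_add)
  qed
  have I_norm_sums: "(\<lambda>n. of_real (norm (I z (Suc n) b u))) sums J (of_real (Re z)) b u"
    if "Re z > 0" for z b u
    unfolding norm_I using that by (intro I_sums) simp
  have I_norm_summable: "summable (\<lambda>n. norm (I z (Suc n) b u))" if "Re z > 0" for z b u
    using sums_summable[OF I_norm_sums[OF that]] by (simp only: summable_complex_of_real)
  have norm_int: "of_real (LINT u|lborel. norm (I z a b u)) = k (of_real (Re z)) a b"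
    if "a > 0" "b > 0" "Re z > 0" for z a b
  proof -
    have "I (of_real (Re z)) a b = (\<lambda>u. of_real (norm (I z a b u)))"
      by (simp add: norm_I fun_eq_iff)
    then show ?thesis
      using I_k[of a b "of_real (Re z)"] that by (metis Re_complex_of_real integral_complex_of_real)
  qed
  have inner: "integrable lborel (J z b)" "((\<lambda>a. k z a b) has_sum integral\<^sup>L lborel (J z b)) {0<..}"
    if "b > 0" "Re z > 0" for z b
  proof -
    have "(\<lambda>a. k w a b) summable_on {0<..}" if "Re w > 0" for w
      using summable_on_SigmaD1[OF summ[OF that], of b] \<open>b > 0\<close> by simp
    then have has: "((\<lambda>n. k w (Suc n) b) has_sum infsum (\<lambda>a. k w a b) {0<..}) UNIV" if "Re w > 0" for w
      using that by (subst has_sum_positive_iff_Suc[symmetric, where f = "\<lambda>a. k w a b"]) simp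
    have "summable (\<lambda>n. k (of_real (Re z)) (Suc n) b)"
      using has_sum_imp_sums[OF has[of "of_real (Re z)"]] that by (simp add: sums_summable)
    then have "summable (\<lambda>n. of_real (LINT u|lborel. norm (I z (Suc n) b u)) :: complex)"
      using that by (simp only: norm_int zero_less_Suc)
    then have 1: "summable (\<lambda>n. LINT u|lborel. norm (I z (Suc n) b u))"
      by (simp only: summable_complex_of_real)
    have 2: "(\<lambda>u. \<Sum>n. I z (Suc n) b u) = J z b"
      using I_sums[OF that(2)] by (simp add: sums_iff fun_eq_iff)
    have 3: "AE u in lborel. summable (\<lambda>n. norm (I z (Suc n) b u))"
      using I_norm_summable[OF that(2)] by simp
    have 4: "integrable lborel (I z (Suc n) b)" for n using that by (intro I_int) auto
    show "integrable lborel (J z b)"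
      using integrable_suminf[OF 4 3 1] unfolding 2 .
    have "(\<lambda>n. integral\<^sup>L lborel (I z (Suc n) b)) sums integral\<^sup>L lborel (J z b)"
      using sums_integral[OF 4 3 1] unfolding 2 .
    then have "(\<lambda>n. k z (Suc n) b) sums integral\<^sup>L lborel (J z b)"
      using that by (simp only: I_k zero_less_Suc)
    with has_sum_imp_sums[OF has[OF that(2)]]
    have "infsum (\<lambda>a. k z a b) {0<..} = integral\<^sup>L lborel (J z b)"
      by (rule sums_unique2)
    with has[OF that(2)] show "((\<lambda>a. k z a b) has_sum integral\<^sup>L lborel (J z b)) {0<..}"
      by (subst has_sum_positive_iff_Suc) simp
  qed
  \<comment> \<open>Stated for every \<open>z\<close> in the half-plane, since it serves at the
    given \<open>z\<close> and, as a majorant, at \<open>Re z\<close>.\<close>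
  have outer: "\<exists>S. ((\<lambda>(b, a). k z a b) has_sum S) ({0<..} \<times> {0<..}) \<and>
      (\<lambda>m. integral\<^sup>L lborel (J z (Suc m))) sums S" if "Re z > 0" for z
  proof -
    note z = that
    obtain S where S: "((\<lambda>(b, a). k z a b) has_sum S) ({0<..} \<times> {0<..})"
      using summ[OF z] by (auto simp: summable_on_def)
    have "((\<lambda>b. integral\<^sup>L lborel (J z b)) has_sum S) {0<..}"
      using S by (rule has_sum_SigmaD) (use inner z in auto)
    then show ?thesis
      using S by (auto simp: has_sum_positive_iff_Suc dest: has_sum_imp_sums)
  qed
  obtain S where S: "((\<lambda>(b, a). k z a b) has_sum S) ({0<..} \<times> {0<..})"
      "(\<lambda>m. integral\<^sup>L lborel (J z (Suc m))) sums S"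
    using outer[OF z] by blast
  have J_norm: "norm (J z b u) \<le> Re (J (of_real (Re z)) b u)" for b u
  proof -
    have "norm (J z b u) \<le> (\<Sum>n. norm (I z (Suc n) b u))"
      using summable_norm[OF I_norm_summable[OF z]] I_sums[OF z] by (simp add: sums_iff)
    also have "(\<lambda>n. norm (I z (Suc n) b u)) sums Re (J (of_real (Re z)) b u)"
      using sums_Re[OF I_norm_sums[OF z]] by simp
    then have "(\<Sum>n. norm (I z (Suc n) b u)) = Re (J (of_real (Re z)) b u)"
      by (simp add: sums_iff)
    finally show ?thesis .
  qed
  have J_sums: "(\<lambda>m. exp (- (w * of_real (exp (- u)) * of_nat (Suc m))))
     sums bose (w * of_real (exp (- u)))" if "Re w > 0" for w u
    using that by (intro bose_sums) simp
  have J_eq: "J w (Suc m) u = bose (w * of_real (exp u)) * exp (- (w * of_real (exp (- u)) * of_nat (Suc m)))"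
    for w m u unfolding J_def by (simp add: algebra_simps)
  have J_sums': "(\<lambda>m. J w (Suc m) u) sums (bose (w * of_real (exp u)) * bose (w * of_real (exp (- u))))"
    if "Re w > 0" for w u
    unfolding J_eq using J_sums[OF that] by (intro sums_mult)
  have "summable (\<lambda>m. Re (J (of_real (Re z)) (Suc m) u))" for u
    using sums_Re[OF J_sums'[of "of_real (Re z)" u]] z by (simp add: sums_summable)
  then have 5: "summable (\<lambda>m. norm (J z (Suc m) u))" for u
    by (rule summable_comparison_test'[where N = 0]) (use J_norm in auto)
  have 6: "summable (\<lambda>m. LINT u|lborel. norm (J z (Suc m) u))"
  proof (rule summable_comparison_test'[where N = 0])
    obtain S' where "(\<lambda>m. integral\<^sup>L lborel (J (of_real (Re z)) (Suc m))) sums S'"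
      using outer[of "of_real (Re z)"] z by auto
    then show "summable (\<lambda>m. Re (integral\<^sup>L lborel (J (of_real (Re z)) (Suc m))))"
      using sums_Re sums_summable by blast
    show "norm (LINT u|lborel. norm (J z (Suc m) u)) \<le> Re (integral\<^sup>L lborel (J (of_real (Re z)) (Suc m)))" for m
    proof -
      have i: "integrable lborel (J (of_real (Re z)) (Suc m))" "integrable lborel (J z (Suc m))"
        using z by (auto intro: inner)
      then have "(LINT u|lborel. norm (J z (Suc m) u)) \<le> (LINT u|lborel. Re (J (of_real (Re z)) (Suc m) u))"
        by (intro integral_mono J_norm) auto
      also have "\<dots> = Re (integral\<^sup>L lborel (J (of_real (Re z)) (Suc m)))"
        using i by simp
      finally show ?thesis by simp
    qed
  qed
  have "(\<lambda>m. integral\<^sup>L lborel (J z (Suc m))) sums (LINT u|lborel. (\<Sum>m. J z (Suc m) u))"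
    using z 5 6 by (intro sums_integral inner) auto
  also have "(\<lambda>u. \<Sum>m. J z (Suc m) u) = (\<lambda>u. bose (z * of_real (exp u)) * bose (z * of_real (exp (- u))))"
    using J_sums'[OF z] by (simp add: sums_iff fun_eq_iff)
  also have "integral\<^sup>L lborel \<dots> = theta z" by (simp add: theta_def)
  finally have "S = theta z" using S(2) sums_unique2 by blast
  with S(1) show "((\<lambda>(a, b). kern (z * of_real (sqrt (real (a * b))))) has_sum theta z) ({0<..} \<times> {0<..})"
    by (simp add: k_def mult.commute)
  have "integrable lborel (\<lambda>u. \<Sum>m. J z (Suc m) u)"
    using z 5 6 by (intro integrable_suminf inner) auto
  also have "(\<lambda>u. \<Sum>m. J z (Suc m) u) = (\<lambda>u. bose (z * of_real (exp u)) * bose (z * of_real (exp (- u))))"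
    using J_sums'[OF z] by (simp add: sums_iff fun_eq_iff)
  finally show "integrable lborel (\<lambda>u. bose (z * of_real (exp u)) * bose (z * of_real (exp (- u))))" .
qed

section \<open>Behaviour of the summed kernel near the imaginary axis\<close>

lemma norm_exp_minus_one_bounds:
  fixes w :: complex
  assumes "norm w \<le> 1/4"
  shows "norm (exp w - 1 - w) \<le> 2 * (norm w)\<^sup>2" "norm (exp w - 1) \<ge> norm w / 2"
proof -
  have "\<bar>Re w\<bar> \<le> 1/4" using abs_Re_le_cmod[of w] assms by linarith
  then have "exp \<bar>Re w\<bar> \<le> exp (1/4)" by simp
  also have "exp (1/4 :: real) \<le> 2" using exp_bound[of "1/4 :: real"] by (simp add: power2_eq_square)
  finally have "exp \<bar>Re w\<bar> \<le> 2" .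
  then have "exp \<bar>Re w\<bar> * (norm w)\<^sup>2 \<le> 2 * (norm w)\<^sup>2" by (intro mult_right_mono) auto
  with Taylor_exp[of w 1] show *: "norm (exp w - 1 - w) \<le> 2 * (norm w)\<^sup>2"
    by (simp add: numeral_2_eq_2 diff_diff_eq)
  have "2 * (norm w)\<^sup>2 \<le> norm w / 2"
    using mult_left_mono[OF assms, of "norm w"] by (simp add: power2_eq_square)
  with * norm_triangle_ineq2[of w "- (exp w - 1 - w)"] show "norm (exp w - 1) \<ge> norm w / 2"
    by (simp add: norm_minus_commute)
qed

text \<open>The pole at 0 is simple with residue 1: in
  \<open>bose w - 1 / w = - (exp w - 1 - w) / (w * (exp w - 1))\<close> the numerator is
  quadratically small and the denominator is at least \<open>|w|^2 / 2\<close>. At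
  \<open>w = 0\<close> all quotients are 0 by the convention on division by zero.\<close>

lemma bose_near_zero:
  assumes "norm w \<le> 1/4"
  shows "norm (bose w) \<le> 2 / norm w" "norm (bose w - 1 / w) \<le> 4"
proof -
  note b = norm_exp_minus_one_bounds[OF assms]
  show "norm (bose w) \<le> 2 / norm w"
  proof (cases "w = 0")
    case False
    then have "1 / norm (exp w - 1) \<le> 1 / (norm w / 2)"
      using b(2) by (intro divide_left_mono mult_pos_pos) (auto intro: less_le_trans[of 0 "norm w / 2"])
    then show ?thesis by (simp add: bose_def norm_divide)
  qed (simp add: bose_def)
  show "norm (bose w - 1 / w) \<le> 4"
  proof (cases "w = 0")
    case False
    then have pos: "norm w / 2 > 0" by simp
    then have e0: "exp w - 1 \<noteq> 0" using b(2) by auto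
    have "bose w - 1 / w = - (exp w - 1 - w) / (w * (exp w - 1))"
      using False e0 by (simp add: bose_def field_simps)
    then have "norm (bose w - 1 / w) = norm (exp w - 1 - w) / (norm w * norm (exp w - 1))"
      by (simp add: norm_divide norm_mult norm_minus_commute)
    also have "\<dots> \<le> 2 * (norm w)\<^sup>2 / (norm w * (norm w / 2))"
      using b pos by (intro frac_le mult_left_mono) auto
    also have "\<dots> = 4" using False by (simp add: power2_eq_square)
    finally show ?thesis .
  qed (simp add: bose_def)
qed

text \<open>The poles of \<open>bose\<close> are the integer multiples of
  \<open>2 * pi * \<i>\<close>. For \<open>0 <= Im w <= c < 2 * pi\<close> only the one at 0 can be
  met, and its principal part is subtracted; outside the disc of radius 1/4 compactness gives the
  bound.\<close>

lemma bose_minus_inverse_bounded: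
  assumes "c < 2 * pi"
  obtains C where "C > 0" "\<And>w. 0 < Re w \<Longrightarrow> Re w \<le> 1 \<Longrightarrow> 0 \<le> Im w \<Longrightarrow> Im w \<le> c \<Longrightarrow>
     norm (bose w - 1 / w) \<le> C"
proof -
  define K where "K = cbox (Complex 0 0) (Complex 1 c) - ball 0 (1/4)"
  have "compact K" unfolding K_def by (intro compact_diff compact_cbox) auto
  have "continuous_on K (\<lambda>w. bose w - 1 / w)"
    unfolding bose_def
  proof (intro continuous_intros ballI)
    fix w assume w: "w \<in> K"
    then show w0: "w \<noteq> 0" by (auto simp: K_def)
    have "0 \<le> Im w" "Im w \<le> c" using w by (auto simp: K_def in_cbox_complex_iff)
    show "exp w - 1 \<noteq> 0"
    proof
      assume "exp w - 1 = 0"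
      then obtain n :: int where n: "Re w = 0" "Im w = of_int (2 * n) * pi"
        using exp_eq_1[of w] by auto
      have "2 * (real_of_int n * pi) < 2 * pi"
        using n(2) \<open>Im w \<le> c\<close> assms by (simp only: of_int_mult of_int_numeral mult.assoc)
      then have "real_of_int n * pi < 1 * pi" by linarith
      then have "n < 1" by (simp only: mult_less_cancel_right_pos pi_gt_zero of_int_less_1_iff)
      moreover have "n \<ge> 0" using n \<open>0 \<le> Im w\<close> pi_gt3 by (auto simp: zero_le_mult_iff)
      ultimately have "Im w = 0" using n by simp
      with n(1) w0 show False by (simp add: complex_eq_iff)
    qed
  qed
  then have "bounded ((\<lambda>w. bose w - 1 / w) ` K)"
    using \<open>compact K\<close> by (intro compact_imp_bounded compact_continuous_image)
  then obtain B where B: "\<And>w. w \<in> K \<Longrightarrow> norm (bose w - 1 / w) \<le> B"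
    by (auto simp: bounded_iff)
  have "norm (bose w - 1 / w) \<le> max 4 B" if "0 < Re w" "Re w \<le> 1" "0 \<le> Im w" "Im w \<le> c" for w
  proof (cases "norm w \<le> 1/4")
    case True
    then show ?thesis using bose_near_zero(2)[of w] by simp
  next
    case False
    then have "w \<in> K" using that by (auto simp: K_def in_cbox_complex_iff)
    then show ?thesis using B[of w] by simp
  qed
  then show ?thesis by (intro that[of "max 4 B"]) auto
qed

lemma norm_bose_le_inverse:
  assumes "Re w > 0"
  shows "norm (bose w) \<le> 1 / Re w" "norm (bose w) \<le> 2 / (Re w)\<^sup>2"
proof -
  have e: "exp (Re w) - 1 \<ge> Re w" "exp (Re w) - 1 \<ge> (Re w)\<^sup>2 / 2"
    using exp_lower_Taylor_quadratic[of "Re w"] exp_ge_add_one_self[of "Re w"] assms by linarith+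
  have "1 / (exp (Re w) - 1) \<le> 1 / Re w"
    using e assms by (intro divide_left_mono mult_pos_pos) linarith+
  then show "norm (bose w) \<le> 1 / Re w" using norm_bose_le[OF assms] by linarith
  have "1 / (exp (Re w) - 1) \<le> 1 / ((Re w)\<^sup>2 / 2)"
    using e assms by (intro divide_left_mono mult_pos_pos) auto
  then show "norm (bose w) \<le> 2 / (Re w)\<^sup>2" using norm_bose_le[OF assms] by simp
qed

lemma set_integrable_exp_minus:
  assumes "d \<ge> 0"
  shows "set_integrable lborel {d<..} (\<lambda>u::real. exp (- u))"
  using set_integrable_subset[OF integrable_I0i_exp_mscale[of 1], of "{d<..}"] assms by auto

text \<open>The function \<open>1 - exp (- w)\<close> has logarithmic derivative
  \<open>bose w\<close>, so the integral is explicit. As \<open>norm (exp (- w)) < 1\<close> for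
  \<open>Re w > 0\<close>, the argument of \<open>Ln\<close> stays in the right half-plane, off the
  branch cut, and it tends to 1 as \<open>u\<close> grows.\<close>

lemma bose_exp_integral:
  assumes "Re z > 0" "d \<ge> 0"
  shows "set_integrable lborel {d<..} (\<lambda>u. bose (z * of_real (exp u)) * of_real (exp u))"
    and "(LINT u:{d<..}|lborel. bose (z * of_real (exp u)) * of_real (exp u))
           = - (Ln (1 - exp (- (z * of_real (exp d)))) / z)"
proof -
  define f where "f = (\<lambda>u. bose (z * of_real (exp u)) * of_real (exp u))"
  define F where "F = (\<lambda>u. Ln (1 - exp (- (z * of_real (exp u)))) / z)"
  have z0: "z \<noteq> 0" using assms by auto
  have Re1: "Re (1 - exp (- (z * of_real (exp u)))) > 0" for u :: real
  proof -
    have "norm (exp (- (z * of_real (exp u)))) < 1" using assms by simp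
    then have "Re (exp (- (z * of_real (exp u)))) < 1"
      using complex_Re_le_cmod order_le_less_trans by blast
    then show ?thesis by simp
  qed
  have nz: "exp (z * of_real (exp u)) - 1 \<noteq> 0" for u :: real
  proof
    assume "exp (z * of_real (exp u)) - 1 = 0"
    then have "exp (- (z * of_real (exp u))) = 1" by (simp add: exp_minus)
    then show False using Re1[of u] by simp
  qed
  have "norm (f u) \<le> 2 / (Re z)\<^sup>2 * exp (- u)" for u
  proof -
    have "norm (bose (z * of_real (exp u))) \<le> 2 / (Re z * exp u)\<^sup>2"
      using norm_bose_le_inverse(2)[of "z * of_real (exp u)"] assms by simp
    then have "norm (f u) \<le> 2 / (Re z * exp u)\<^sup>2 * exp u"
      unfolding f_def norm_mult by (intro mult_mono) auto
    also have "\<dots> = 2 / (Re z)\<^sup>2 * exp (- u)"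
      by (simp add: exp_minus power2_eq_square divide_simps)
    finally show ?thesis .
  qed
  then have "set_integrable lborel {d<..} f"
    by (intro set_integrable_bound[OF set_integrable_mult_right[OF set_integrable_exp_minus[OF assms(2)],
          of "2 / (Re z)\<^sup>2"]]) (auto simp: f_def set_borel_measurable_def)
  then show "set_integrable lborel {d<..} (\<lambda>u. bose (z * of_real (exp u)) * of_real (exp u))"
    by (simp add: f_def)
  have F': "(F has_vector_derivative f u) (at u)" for u
  proof -
    have 1: "((\<lambda>u. of_real (exp u)) has_vector_derivative (of_real (exp u) :: complex)) (at u)"
      by (intro has_vector_derivative_of_real has_real_derivative_iff_has_vector_derivative[THEN iffD1])
         (auto intro!: derivative_eq_intros)
    define E where "E = exp (z * of_real (exp u))"
    have "((\<lambda>w. Ln (1 - exp (- (z * w))) / z) has_field_derivative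
        exp (- (z * of_real (exp u))) * z / (1 - exp (- (z * of_real (exp u)))) / z) (at (of_real (exp u)))"
      using Re1[of u] z0
      by (auto intro!: derivative_eq_intros simp: complex_nonpos_Reals_iff divide_inverse mult.commute)
    moreover have "exp (- (z * of_real (exp u))) * z / (1 - exp (- (z * of_real (exp u)))) / z
        = bose (z * of_real (exp u))"
    proof -
      have "exp (- (z * of_real (exp u))) / (1 - exp (- (z * of_real (exp u)))) = 1 / (E - 1)"
        using nz[of u] by (simp add: exp_minus E_def[symmetric] field_simps) (simp add: E_def)?
      then show ?thesis using z0 by (simp add: bose_def E_def)
    qed
    ultimately have 2: "((\<lambda>w. Ln (1 - exp (- (z * w))) / z) has_field_derivative
        bose (z * of_real (exp u))) (at (of_real (exp u)))" by simp
    from field_vector_diff_chain_at[OF 1 2] show ?thesis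
      by (simp add: F_def f_def o_def mult.commute)
  qed
  have "(LBINT u=ereal d..\<infinity>. f u) = 0 - F d"
  proof (rule interval_integral_FTC_integrable)
    show "isCont f u" for u
      unfolding f_def bose_def by (intro continuous_intros nz)
    show "set_integrable lborel (einterval (ereal d) \<infinity>) f" by (simp add: \<open>set_integrable lborel {d<..} f\<close>)
    have "isCont F d" using F'[of d] has_vector_derivative_continuous by blast
    then show "((F \<circ> real_of_ereal) \<longlongrightarrow> F d) (at_right (ereal d))"
      by (auto simp: ereal_tendsto_simps isCont_def intro: filterlim_mono at_le)
    have "((\<lambda>u. exp (- (z * of_real (exp u)))) \<longlongrightarrow> 0) at_top"
    proof (rule tendsto_norm_zero_cancel)
      have "((\<lambda>u. exp (- (Re z * exp u))) \<longlongrightarrow> 0) at_top"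
        using assms by real_asymp
      then show "((\<lambda>u. norm (exp (- (z * of_real (exp u))))) \<longlongrightarrow> 0) at_top" by simp
    qed
    then have "(F \<longlongrightarrow> Ln (1 - 0) / z) at_top"
      unfolding F_def using z0 by (intro tendsto_intros) (auto simp: complex_nonpos_Reals_iff)
    then show "((F \<circ> real_of_ereal) \<longlongrightarrow> 0) (at_left \<infinity>)"
      by (simp add: ereal_tendsto_simps)
  qed (use F' in auto)
  then show "(LINT u:{d<..}|lborel. bose (z * of_real (exp u)) * of_real (exp u))
           = - (Ln (1 - exp (- (z * of_real (exp d)))) / z)"
    by (simp add: interval_lebesgue_integral_def f_def F_def)
qed

section \<open>The range of integration away from the pinch\<close>

text \<open>The alternative \<open>y < 1\<close> or \<open>0 < d\<close> gives
  \<open>y * exp (- d) < 1\<close>, so for \<open>u > d\<close> the argument of the second factor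
  stays away from every pole except 0. Only the first factor can then approach a nonzero pole, and
  such an unpaired pole is too weak to survive multiplication by \<open>s n\<close>.\<close>

lemma theta_tail_tendsto:
  fixes s :: "nat \<Rightarrow> real"
  assumes s: "\<And>n. 0 < s n" "\<And>n. s n \<le> 1" "s \<longlonglongrightarrow> 0"
    and y: "0 < y" "y \<le> 1" and d: "0 \<le> d" "y < 1 \<or> 0 < d"
    and z: "\<And>n. z n = Complex (s n) (2 * pi * y)"
  shows "(\<lambda>n. of_real (s n) * (LINT u:{d<..}|lborel.
           bose (z n * of_real (exp u)) * bose (z n * of_real (exp (- u))))) \<longlonglongrightarrow> 0"
proof -
  define R where "R = (\<lambda>w. bose w - 1 / w)"
  have Rez: "Re (z n) > 0" and z0: "z n \<noteq> 0" for n using s(1)[of n] by (auto simp: z complex_eq_iff)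
  have "y * exp (- d) < 1"
  proof (cases "y < 1")
    case True
    have "y * exp (- d) \<le> y * 1" using y d by (intro mult_left_mono) auto
    with True show ?thesis by linarith
  next
    case False
    then have "exp (- d) < 1" using d by simp
    moreover have "y * exp (- d) \<le> 1 * exp (- d)" using y by (intro mult_right_mono) auto
    ultimately show ?thesis by linarith
  qed
  then have "2 * pi * y * exp (- d) < 2 * pi" using mult_strict_left_mono[of _ 1 "2 * pi"] by simp
  then obtain C where C: "C > 0" "\<And>w. 0 < Re w \<Longrightarrow> Re w \<le> 1 \<Longrightarrow> 0 \<le> Im w \<Longrightarrow>
      Im w \<le> 2 * pi * y * exp (- d) \<Longrightarrow> norm (R w) \<le> C"
    unfolding R_def using bose_minus_inverse_bounded by blast
  have R_le: "norm (R (z n * of_real (exp (- u)))) \<le> C" if "u > d" for n u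
  proof (rule C(2))
    show "Re (z n * of_real (exp (- u))) \<le> 1"
      using mult_mono[of "s n" 1 "exp (- u)" 1] s(1,2)[of n] that d by (simp add: z)
  qed (use Rez[of n] s(1,2)[of n] y that in \<open>auto simp: z\<close>)
  have R_meas [measurable]: "R \<in> borel_measurable borel" unfolding R_def by measurable
  have bose_le: "norm (of_real (s n) * bose (z n * of_real (exp u))) \<le> exp (- u)" for n u
    using norm_bose_le_inverse(1)[of "z n * of_real (exp u)"] s(1)[of n]
    by (simp add: norm_mult z exp_minus field_simps)
  \<comment> \<open>\<open>bose (z e\<^sup>-\<^sup>u) = e\<^sup>u / z + R (z e\<^sup>-\<^sup>u)\<close> with \<open>R\<close> bounded: the first part is integrated explicitly
    because it admits no integrable majorant uniform in \<open>n\<close>, the second vanishes by dominated convergence\<close>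
  define f where "f = (\<lambda>n u. bose (z n * of_real (exp u)) * of_real (exp u))"
  define g where "g = (\<lambda>n u. of_real (s n) * bose (z n * of_real (exp u)) * R (z n * of_real (exp (- u))))"
  have g_le: "norm (g n u) \<le> C * exp (- u)" if "u > d" for n u
    unfolding g_def norm_mult[of "_ * _"]
    using mult_mono[OF bose_le[of n u] R_le[OF that, of n]] by (simp add: mult.commute)
  have g_int: "set_integrable lborel {d<..} (g n)" for n
    by (rule set_integrable_bound[OF set_integrable_mult_right[OF set_integrable_exp_minus[OF d(1)], of C]])
       (use g_le C(1) in \<open>auto simp: g_def set_borel_measurable_def\<close>)
  have split: "of_real (s n) * (LINT u:{d<..}|lborel. bose (z n * of_real (exp u)) * bose (z n * of_real (exp (- u))))
     = of_real (s n) / z n * (LINT u:{d<..}|lborel. f n u) + (LINT u:{d<..}|lborel. g n u)" for n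
  proof -
    have eq: "of_real (s n) * (bose (z n * of_real (exp u)) * bose (z n * of_real (exp (- u))))
        = of_real (s n) / z n * f n u + g n u" for u
    proof -
      have "bose (z n * of_real (exp (- u))) = of_real (exp u) / z n + R (z n * of_real (exp (- u)))"
        using z0[of n] by (simp add: R_def exp_minus divide_simps)
      then show ?thesis by (simp add: f_def g_def algebra_simps)
    qed
    have fi: "set_integrable lborel {d<..} (f n)"
      unfolding f_def by (rule bose_exp_integral(1)[OF Rez d(1)])
    have "of_real (s n) * (LINT u:{d<..}|lborel. bose (z n * of_real (exp u)) * bose (z n * of_real (exp (- u))))
      = (LINT u:{d<..}|lborel. of_real (s n) / z n * f n u + g n u)"
      by (subst set_integral_mult_right[symmetric]) (simp only: eq)
    also have "\<dots> = (LINT u:{d<..}|lborel. of_real (s n) / z n * f n u) + (LINT u:{d<..}|lborel. g n u)"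
      by (intro set_integral_add set_integrable_mult_right fi g_int)
    finally show ?thesis by simp
  qed
  have lim_f: "(\<lambda>n. of_real (s n) / z n * (LINT u:{d<..}|lborel. f n u)) \<longlonglongrightarrow> 0"
  proof (rule Lim_null_comparison)
    \<comment> \<open>Majorant for the explicit logarithm: \<open>norm q\<close> lies between
      \<open>1 - exp (- s n)\<close> and 2, and the imaginary part of \<open>Ln q\<close>
      contributes at most \<open>pi\<close>. The factor \<open>x\<close> absorbs the logarithmic
      growth.\<close>
    define h where "h = (\<lambda>x::real. x * (ln 2 + pi - ln (1 - exp (- x))) / (2 * pi * y)\<^sup>2)"
    have "(h \<longlongrightarrow> 0) (at_right 0)"
      unfolding h_def using y by real_asymp
    moreover have "filterlim s (at_right 0) sequentially"
      using s by (intro tendsto_imp_filterlim_at_right) auto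
    ultimately show "(\<lambda>n. h (s n)) \<longlonglongrightarrow> 0" by (rule filterlim_compose)
    have "norm (of_real (s n) / z n * (LINT u:{d<..}|lborel. f n u)) \<le> h (s n)" for n
    proof -
      define q where "q = 1 - exp (- (z n * of_real (exp d)))"
      have "s n * 1 \<le> s n * exp d" using s(1)[of n] d by (intro mult_left_mono) auto
      then have e1: "exp (- (s n * exp d)) \<le> exp (- s n)" by simp
      have ne: "norm (exp (- (z n * of_real (exp d)))) = exp (- (s n * exp d))" by (simp add: z)
      have "norm q \<ge> 1 - exp (- s n)"
        using norm_triangle_ineq2[of 1 "exp (- (z n * of_real (exp d)))"] e1
        unfolding ne q_def[symmetric] norm_one by linarith
      moreover have s_pos: "1 - exp (- s n) > 0" using s(1)[of n] by simp
      ultimately have q: "norm q \<ge> 1 - exp (- s n)" "norm q > 0" "q \<noteq> 0" by auto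
      have "norm q \<le> 1 + exp (- (s n * exp d))"
        using norm_triangle_ineq4[of 1 "exp (- (z n * of_real (exp d)))"] ne by (simp add: q_def)
      also have "\<dots> \<le> 2" using s(1)[of n] by simp
      finally have q2: "norm q \<le> 2" .
      have "ln (norm q) \<le> ln 2" "ln (norm q) \<ge> ln (1 - exp (- s n))"
        using q q2 s_pos by (simp_all only: ln_le_cancel_iff zero_less_numeral)
      moreover have "ln (1 - exp (- s n)) \<le> 0" using s(1)[of n] by (simp add: ln_le_zero_iff)
      moreover have "ln 2 \<ge> (0::real)" by simp
      ultimately have "\<bar>Re (Ln q)\<bar> \<le> ln 2 - ln (1 - exp (- s n))"
        unfolding Re_Ln[OF q(3)] by linarith
      moreover have "\<bar>Im (Ln q)\<bar> \<le> pi" using q mpi_less_Im_Ln[of q] Im_Ln_le_pi[of q] by (simp add: abs_le_iff)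
      ultimately have Lq: "norm (Ln q) \<le> ln 2 + pi - ln (1 - exp (- s n))"
        using cmod_le[of "Ln q"] by linarith
      have "2 * pi * y \<le> norm (z n)" using abs_Im_le_cmod[of "z n"] y by (simp add: z)
      then have zz: "(2 * pi * y)\<^sup>2 \<le> norm (z n) * norm (z n)"
        unfolding power2_eq_square using y by (intro mult_mono) auto
      have "of_real (s n) / z n * (LINT u:{d<..}|lborel. f n u) = - (of_real (s n) * Ln q / (z n * z n))"
        unfolding f_def bose_exp_integral(2)[OF Rez d(1)] q_def by simp
      then have "norm (of_real (s n) / z n * (LINT u:{d<..}|lborel. f n u)) = s n * norm (Ln q) / (norm (z n) * norm (z n))"
        using s(1)[of n] by (simp add: norm_mult norm_divide)
      also have "\<dots> \<le> s n * (ln 2 + pi - ln (1 - exp (- s n))) / (2 * pi * y)\<^sup>2"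
        using Lq zz s(1)[of n] y order_trans[OF norm_ge_zero Lq] by (intro frac_le mult_left_mono) auto
      finally show ?thesis by (simp add: h_def)
    qed
    then show "\<forall>\<^sub>F n in sequentially. norm (of_real (s n) / z n * (LINT u:{d<..}|lborel. f n u)) \<le> h (s n)"
      by simp
  qed
  have lim_g: "(\<lambda>n. LINT u|lborel. indicator {d<..} u *\<^sub>R g n u) \<longlonglongrightarrow> (LINT u|(lborel :: real measure). 0)"
  proof (rule integral_dominated_convergence[where w = "\<lambda>u. indicator {d<..} u *\<^sub>R (C * exp (- u))"])
    show "integrable lborel (\<lambda>u. indicator {d<..} u *\<^sub>R (C * exp (- u)))"
      using set_integrable_mult_right[OF set_integrable_exp_minus[OF d(1)], of C]
      by (simp add: set_integrable_def)
    show "AE u in lborel. norm (indicator {d<..} u *\<^sub>R g n u) \<le> indicator {d<..} u *\<^sub>R (C * exp (- u))" for n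
      using g_le by (auto simp: indicator_def)
    \<comment> \<open>Outside this countable set the limit point
      \<open>2 * pi * y * \<i> * exp u\<close> is not a pole of \<open>bose\<close>, so the
      integrand tends to 0 there.\<close>
    define N where "N = range (\<lambda>k::int. ln (of_int k / y))"
    have "N \<in> null_sets lborel" unfolding N_def by (intro countable_imp_null_set_lborel) auto
    then have "AE u in lborel. u \<notin> N" by (rule AE_not_in)
    then show "AE u in lborel. (\<lambda>n. indicator {d<..} u *\<^sub>R g n u) \<longlonglongrightarrow> 0"
    proof eventually_elim
      case (elim u)
      show ?case
      proof (cases "u > d")
        case True
        define w where "w = Complex 0 (2 * pi * y) * of_real (exp u)"
        have "exp w \<noteq> 1"
        proof
          assume "exp w = 1"
          then obtain k :: int where "2 * pi * y * exp u = of_int (2 * k) * pi"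
            using exp_eq_1[of w] by (auto simp: w_def)
          then have "exp u = of_int k / y" using y by (simp add: field_simps)
          then have "u = ln (of_int k / y)" by (metis ln_exp)
          with elim show False by (auto simp: N_def)
        qed
        have "(\<lambda>n. Complex (s n) (2 * pi * y)) \<longlonglongrightarrow> Complex 0 (2 * pi * y)"
          by (intro tendsto_Complex s tendsto_const)
        then have "(\<lambda>n. of_real (s n) * bose (z n * of_real (exp u))) \<longlonglongrightarrow> of_real 0 * (1 / (exp w - 1))"
          unfolding bose_def z w_def
          by (intro tendsto_intros s) (use \<open>exp w \<noteq> 1\<close> in \<open>simp add: w_def\<close>)
        then have "(\<lambda>n. norm (of_real (s n) * bose (z n * of_real (exp u))) * C) \<longlonglongrightarrow> norm (0::complex) * C"
          by (intro tendsto_intros) simp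
        then have lim: "(\<lambda>n. norm (of_real (s n) * bose (z n * of_real (exp u))) * C) \<longlonglongrightarrow> 0"
          by simp
        have "(\<lambda>n. g n u) \<longlonglongrightarrow> 0"
        proof (rule Lim_null_comparison[OF _ lim], intro always_eventually allI)
          show "norm (g n u) \<le> norm (of_real (s n) * bose (z n * of_real (exp u))) * C" for n
            unfolding g_def norm_mult[of "_ * _" "R _"] by (intro mult_left_mono R_le True norm_ge_zero)
        qed
        then show ?thesis by (simp add: True)
      qed simp
    qed
  qed (auto simp: g_def)
  show ?thesis unfolding split using tendsto_add[OF lim_f lim_g] by (simp add: set_lebesgue_integral_def)
qed

section \<open>The pinch at \<open>2 * pi * \<i>\<close>\<close>

text \<open>Subtracting the period \<open>2 * pi * \<i>\<close> moves the pole to 0, where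
  \<open>norm (bose w) <= 2 / norm w\<close>. The real part of \<open>w\<close> is at least
  \<open>s / 2\<close> and its imaginary part at least \<open>|t|\<close> in modulus, which yields
  the maximum. The limits 1/20 and 1/100 keep \<open>norm w\<close> below 1/4.\<close>

lemma norm_scaled_bose_le:
  assumes "0 < s" "s \<le> 1/20" "\<bar>t\<bar> \<le> 1/100"
  defines "w \<equiv> Complex (s * exp t) (2 * pi * (exp t - 1))"
  shows "bose (Complex s (2 * pi) * of_real (exp t)) = bose w"
    and "norm w \<le> 1/4"
    and "norm (of_real s * bose w) \<le> 4 / max 1 (\<bar>t\<bar> / s)"
proof -
  have "Complex s (2 * pi) * of_real (exp t) = w + 2 * of_real pi * \<i>"
    by (simp add: w_def complex_eq_iff algebra_simps)
  then show "bose (Complex s (2 * pi) * of_real (exp t)) = bose w"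
    by (simp add: bose_def exp_add exp_two_pi_i)
  have exp_near: "\<bar>t\<bar> / 2 \<le> \<bar>exp t - 1\<bar>" "\<bar>exp t - 1\<bar> \<le> 2 * \<bar>t\<bar>"
  proof -
    have tt: "t * t \<le> 1/100 * \<bar>t\<bar>" using assms(3) mult_right_mono[of "\<bar>t\<bar>" "1/100" "\<bar>t\<bar>"] by (simp add: abs_mult_self_eq)
    have lower: "exp t \<ge> 1 + t" by (rule exp_ge_add_one_self)
    have upper: "exp t \<le> 1 + t + t * t"
    proof (cases "t \<ge> 0")
      case True
      then show ?thesis using exp_bound[of t] assms(3) by (simp add: power2_eq_square)
    next
      case False
      have "exp (- t) * (1 + t + t * t) \<ge> (1 - t) * (1 + t + t * t)"
        using exp_ge_add_one_self[of "- t"] tt assms(3) by (intro mult_right_mono) auto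
      also have "(1 - t) * (1 + t + t * t) = 1 - t * t * t" by (simp add: algebra_simps)
      also have "\<dots> \<ge> 1" using False by (simp add: mult_nonneg_nonpos)
      finally show ?thesis by (simp add: exp_minus field_simps)
    qed
    show "\<bar>t\<bar> / 2 \<le> \<bar>exp t - 1\<bar>" "\<bar>exp t - 1\<bar> \<le> 2 * \<bar>t\<bar>"
      using tt lower upper assms(3) by linarith+
  qed
  have et: "exp t \<ge> 1/2" "exp t \<le> 2" using exp_near(2) assms(3) by auto
  have "norm w \<le> \<bar>s * exp t\<bar> + \<bar>2 * pi * (exp t - 1)\<bar>" using cmod_le[of w] by (simp add: w_def)
  also have "\<dots> \<le> 1/20 * 2 + 7 * (2 * (1/100))"
  proof (rule add_mono)
    show "\<bar>s * exp t\<bar> \<le> 1/20 * 2" unfolding abs_mult using assms et by (intro mult_mono) auto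
    have "2 * pi \<le> 7" using pi_approx by simp
    then show "\<bar>2 * pi * (exp t - 1)\<bar> \<le> 7 * (2 * (1/100))"
      unfolding abs_mult using exp_near(2) assms(3) by (intro mult_mono) auto
  qed
  finally show nw: "norm w \<le> 1/4" by simp
  have "s * (1/2) \<le> s * exp t" using et(1) assms(1) by (intro mult_left_mono) auto
  also have "\<dots> \<le> norm w" using complex_Re_le_cmod[of w] by (simp add: w_def)
  finally have "s / 2 \<le> norm w" by simp
  moreover have "\<bar>t\<bar> \<le> norm w"
  proof -
    have "2 * 1 * (\<bar>t\<bar> / 2) \<le> 2 * pi * \<bar>exp t - 1\<bar>"
      using exp_near(1) pi_gt3 by (intro mult_mono) auto
    then show ?thesis using abs_Im_le_cmod[of w] by (simp add: w_def abs_mult)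
  qed
  ultimately have m: "s / 2 * max 1 (\<bar>t\<bar> / s) \<le> norm w"
    using assms(1) by (auto simp: max_def)
  have "s / 2 * max 1 (\<bar>t\<bar> / s) > 0"
    using assms(1) by (intro mult_pos_pos) (auto simp: less_max_iff_disj)
  with m have m_pos: "s / 2 * max 1 (\<bar>t\<bar> / s) > 0" "norm w > 0" by linarith+
  have "norm (of_real s * bose w) \<le> s * (2 / norm w)"
    using mult_left_mono[OF bose_near_zero(1)[OF nw], of s] assms(1) by (simp add: norm_mult)
  also have "\<dots> \<le> s * (2 / (s / 2 * max 1 (\<bar>t\<bar> / s)))"
    using m m_pos assms(1) by (intro mult_left_mono divide_left_mono mult_pos_pos) auto
  also have "\<dots> = 4 / max 1 (\<bar>t\<bar> / s)" using assms(1) by simp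
  finally show "norm (of_real s * bose w) \<le> 4 / max 1 (\<bar>t\<bar> / s)" .
qed

text \<open>After removal of the period, \<open>w n / s n\<close> tends to
  \<open>1 + 2 * pi * \<i> * x\<close>, because \<open>(exp (h * x) - 1) / h\<close> tends to
  \<open>x\<close>. The bounded error \<open>bose w - 1 / w\<close> disappears after scaling by
  \<open>s n\<close>.\<close>

lemma scaled_bose_tendsto:
  fixes s :: "nat \<Rightarrow> real"
  assumes s: "\<And>n. 0 < s n" "\<And>n. s n \<le> 1/20" "s \<longlonglongrightarrow> 0"
  shows "(\<lambda>n. of_real (s n) * bose (Complex (s n) (2 * pi) * of_real (exp (s n * x))))
           \<longlonglongrightarrow> 1 / Complex 1 (2 * pi * x)"
proof -
  define w where "w = (\<lambda>n. Complex (s n * exp (s n * x)) (2 * pi * (exp (s n * x) - 1)))"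
  have sx: "(\<lambda>n. s n * x) \<longlonglongrightarrow> 0" using tendsto_mult_left_zero[OF s(3)] by simp
  have exp_lim: "(\<lambda>n. exp (s n * x)) \<longlonglongrightarrow> 1" using tendsto_exp[OF sx] by simp
  have "((\<lambda>h. exp (h * x)) has_real_derivative x) (at 0)"
    by (auto intro!: derivative_eq_intros)
  then have "((\<lambda>h. (exp (h * x) - 1) / h) \<longlongrightarrow> x) (at 0)"
    by (simp add: has_field_derivative_iff)
  moreover have "filterlim s (at 0) sequentially"
    using s(1,3) by (simp add: filterlim_at less_imp_neq eventually_sequentially) (metis less_irrefl)
  ultimately have diff_lim: "(\<lambda>n. (exp (s n * x) - 1) / s n) \<longlonglongrightarrow> x"
    by (rule filterlim_compose)
  have w_div: "w n / of_real (s n) = Complex (exp (s n * x)) (2 * pi * ((exp (s n * x) - 1) / s n))" for n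
    using s(1)[of n] by (simp add: w_def complex_eq_iff)
  have "(\<lambda>n. w n / of_real (s n)) \<longlonglongrightarrow> Complex 1 (2 * pi * x)"
    unfolding w_div by (intro tendsto_Complex exp_lim tendsto_mult_left diff_lim)
  then have lim1: "(\<lambda>n. 1 / (w n / of_real (s n))) \<longlonglongrightarrow> 1 / Complex 1 (2 * pi * x)"
    by (intro tendsto_divide tendsto_const) (auto simp: complex_eq_iff)
  have ev: "\<forall>\<^sub>F n in sequentially. \<bar>s n * x\<bar> \<le> 1/100"
  proof -
    have "(\<lambda>n. \<bar>s n * x\<bar>) \<longlonglongrightarrow> 0" using sx by (simp add: tendsto_rabs_zero)
    then have "\<forall>\<^sub>F n in sequentially. \<bar>s n * x\<bar> < 1/100" by (rule order_tendstoD) simp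
    then show ?thesis by eventually_elim simp
  qed
  have lim2: "(\<lambda>n. of_real (s n) * (bose (w n) - 1 / w n)) \<longlonglongrightarrow> 0"
  proof (rule Lim_null_comparison)
    show "\<forall>\<^sub>F n in sequentially. norm (of_real (s n) * (bose (w n) - 1 / w n)) \<le> s n * 4"
      using ev
    proof eventually_elim
      case (elim n)
      have "norm (bose (w n) - 1 / w n) \<le> 4"
        unfolding w_def using s(1,2)[of n] elim by (intro bose_near_zero(2) norm_scaled_bose_le(2)) auto
      then show ?case using s(1)[of n] by (simp add: norm_mult mult_left_mono)
    qed
    show "(\<lambda>n. s n * 4) \<longlonglongrightarrow> 0" using tendsto_mult_left_zero[OF s(3)] by simp
  qed
  have "(\<lambda>n. of_real (s n) * bose (w n)) \<longlonglongrightarrow> 1 / Complex 1 (2 * pi * x) + 0"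
  proof (rule Lim_transform_eventually)
    show "(\<lambda>n. 1 / (w n / of_real (s n)) + of_real (s n) * (bose (w n) - 1 / w n))
        \<longlonglongrightarrow> 1 / Complex 1 (2 * pi * x) + 0"
      by (intro tendsto_add lim1 lim2)
    show "\<forall>\<^sub>F n in sequentially. 1 / (w n / of_real (s n)) + of_real (s n) * (bose (w n) - 1 / w n)
       = of_real (s n) * bose (w n)"
      by (simp add: algebra_simps)
  qed
  then have "(\<lambda>n. of_real (s n) * bose (w n)) \<longlonglongrightarrow> 1 / Complex 1 (2 * pi * x)" by simp
  then show ?thesis
  proof (rule Lim_transform_eventually)
    show "\<forall>\<^sub>F n in sequentially. of_real (s n) * bose (w n)
        = of_real (s n) * bose (Complex (s n) (2 * pi) * of_real (exp (s n * x)))"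
      using ev by eventually_elim (use s(1,2) norm_scaled_bose_le(1) in \<open>simp add: w_def\<close>)
  qed
qed

text \<open>In the rescaled variable the factors tend to \<open>1 / (1 + 2 * pi * \<i> * x)\<close>
  and its conjugate, whose product is positive. The bound \<open>4 / max 1 |x|\<close> for each
  factor gives an integrable majorant independent of \<open>n\<close>.\<close>

lemma theta_near_tendsto:
  fixes s :: "nat \<Rightarrow> real"
  assumes s: "\<And>n. 0 < s n" "\<And>n. s n \<le> 1/20" "s \<longlonglongrightarrow> 0"
  shows "(\<lambda>n. of_real (s n) * (LINT u:{0..1/100}|lborel.
           bose (Complex (s n) (2 * pi) * of_real (exp u)) * bose (Complex (s n) (2 * pi) * of_real (exp (- u)))))
         \<longlonglongrightarrow> of_real (LINT x:{0..}|lborel. 1 / (1 + (2 * pi * x)\<^sup>2))"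
proof -
  \<comment> \<open>the substitution \<open>u = s\<^sub>n x\<close> keeps the two pinching poles at fixed positions\<close>
  define b where "b = (\<lambda>n x. of_real (s n) * bose (Complex (s n) (2 * pi) * of_real (exp (s n * x))))"
  have scale: "of_real (s n) * (LINT u:{0..1/100}|lborel.
           bose (Complex (s n) (2 * pi) * of_real (exp u)) * bose (Complex (s n) (2 * pi) * of_real (exp (- u))))
      = (LINT x|lborel. indicator {0..1/100} (s n * x) *\<^sub>R (b n x * b n (- x)))" for n
    unfolding set_lebesgue_integral_def using s(1)[of n]
    by (subst lborel_integral_real_affine[where c = "s n" and t = 0])
       (auto simp: b_def scaleR_conv_of_real mult_ac simp flip: integral_mult_right_zero)
  have "(\<lambda>n. LINT x|lborel. indicator {0..1/100} (s n * x) *\<^sub>R (b n x * b n (- x)))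
     \<longlonglongrightarrow> (LINT x|lborel. indicator {0..} x *\<^sub>R (of_real (1 / (1 + (2 * pi * x)\<^sup>2)) :: complex))"
  proof (rule integral_dominated_convergence[where w = "\<lambda>x. 32 * (1 / (1 + x\<^sup>2))"])
    show "integrable lborel (\<lambda>x::real. 32 * (1 / (1 + x\<^sup>2)))"
      using integrable_inverse_1_plus_square
      by (intro integrable_mult_right) (simp add: set_integrable_def einterval_def inverse_eq_divide)
    show "AE x in lborel. norm (indicator {0..1/100} (s n * x) *\<^sub>R (b n x * b n (- x))) \<le> 32 * (1 / (1 + x\<^sup>2))" for n
    proof (rule AE_I2)
      fix x :: real
      show "norm (indicator {0..1/100} (s n * x) *\<^sub>R (b n x * b n (- x))) \<le> 32 * (1 / (1 + x\<^sup>2))"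
      proof (cases "s n * x \<in> {0..1/100}")
        case True
        then have x: "x \<ge> 0" using s(1)[of n] by (simp add: zero_le_mult_iff)
        have *: "norm (b n y) \<le> 4 / max 1 \<bar>x\<bar>" if "\<bar>y\<bar> = \<bar>x\<bar>" for y
        proof -
          have "\<bar>s n * y\<bar> = s n * x" using that x s(1)[of n] by (simp add: abs_mult)
          then show ?thesis
            using norm_scaled_bose_le(1,3)[of "s n" "s n * y"] s(1,2)[of n] True x by (simp add: b_def)
        qed
        have "norm (b n x * b n (- x)) \<le> 4 / max 1 \<bar>x\<bar> * (4 / max 1 \<bar>x\<bar>)"
          unfolding norm_mult by (intro mult_mono * divide_nonneg_nonneg) auto
        also have "\<dots> = 16 / (max 1 \<bar>x\<bar>)\<^sup>2" by (simp add: power2_eq_square)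
        also have "\<dots> \<le> 16 / ((1 + x\<^sup>2) / 2)"
        proof (intro divide_left_mono mult_pos_pos)
          have "1 + x\<^sup>2 \<le> 2 * (max 1 \<bar>x\<bar>)\<^sup>2"
          proof -
            have "x\<^sup>2 \<le> (max 1 \<bar>x\<bar>)\<^sup>2" unfolding abs_le_square_iff[symmetric] by auto
            moreover have "1 \<le> (max 1 \<bar>x\<bar>)\<^sup>2" by (intro one_le_power) auto
            ultimately show ?thesis by linarith
          qed
          then show "(1 + x\<^sup>2) / 2 \<le> (max 1 \<bar>x\<bar>)\<^sup>2" by simp
        qed (auto simp: add_pos_nonneg less_max_iff_disj)
        finally show ?thesis using True by simp
      qed simp
    qed
    show "AE x in lborel. (\<lambda>n. indicator {0..1/100} (s n * x) *\<^sub>R (b n x * b n (- x)))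
        \<longlonglongrightarrow> indicator {0..} x *\<^sub>R of_real (1 / (1 + (2 * pi * x)\<^sup>2))"
    proof (rule AE_I2)
      fix x :: real
      show "(\<lambda>n. indicator {0..1/100} (s n * x) *\<^sub>R (b n x * b n (- x)))
        \<longlonglongrightarrow> indicator {0..} x *\<^sub>R of_real (1 / (1 + (2 * pi * x)\<^sup>2))"
      proof (cases "x \<ge> 0")
        case True
        have "(\<lambda>n. s n * x) \<longlonglongrightarrow> 0" using tendsto_mult_left_zero[OF s(3)] by simp
        then have "\<forall>\<^sub>F n in sequentially. s n * x < 1/100" by (rule order_tendstoD) simp
        then have ev: "\<forall>\<^sub>F n in sequentially. b n x * b n (- x) = indicator {0..1/100} (s n * x) *\<^sub>R (b n x * b n (- x))"
          by eventually_elim (use True s(1) in \<open>simp add: less_imp_le\<close>)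
        have "(\<lambda>n. b n x * b n (- x)) \<longlonglongrightarrow> 1 / Complex 1 (2 * pi * x) * (1 / Complex 1 (2 * pi * (- x)))"
          unfolding b_def by (intro tendsto_mult scaled_bose_tendsto s)
        also have "1 / Complex 1 (2 * pi * x) * (1 / Complex 1 (2 * pi * (- x))) = of_real (1 / (1 + (2 * pi * x)\<^sup>2))"
        proof -
          have "Complex 1 (2 * pi * x) * Complex 1 (2 * pi * (- x)) = of_real (1 + (2 * pi * x)\<^sup>2)"
            by (simp add: complex_eq_iff power2_eq_square)
          then show ?thesis unfolding times_divide_times_eq by (simp only: mult_1_left of_real_divide of_real_1)
        qed
        finally show ?thesis using Lim_transform_eventually[OF _ ev] True by simp
      next
        case False
        then have "indicator {0..1/100} (s n * x) = (0::real)" for n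
          using s(1)[of n] by (simp add: indicator_def zero_le_mult_iff not_le)
        then show ?thesis using False by simp
      qed
    qed
  qed (auto simp: b_def)
  moreover have "(LINT x|lborel. indicator {0..} x *\<^sub>R (of_real (1 / (1 + (2 * pi * x)\<^sup>2)) :: complex))
      = of_real (LINT x:{0..}|lborel. 1 / (1 + (2 * pi * x)\<^sup>2))"
    unfolding set_lebesgue_integral_def by (subst integral_complex_of_real[symmetric]) (simp add: scaleR_conv_of_real)
  ultimately show ?thesis unfolding scale by simp
qed

lemma integral_inverse_one_plus_square_pos: "(LINT x:{0..}|lborel. 1 / (1 + (2 * pi * x)\<^sup>2)) > 0"
proof -
  have int: "integrable lborel (\<lambda>x::real. 1 / (1 + x\<^sup>2))"
    using integrable_inverse_1_plus_square by (simp add: set_integrable_def einterval_def inverse_eq_divide)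
  have "integrable lborel (\<lambda>x::real. 1 / (1 + (2 * pi * x)\<^sup>2))"
    using lborel_integrable_real_affine[OF int, of "2 * pi" 0] by simp
  then have int': "set_integrable lborel {0..} (\<lambda>x::real. 1 / (1 + (2 * pi * x)\<^sup>2))"
    unfolding set_integrable_def by (intro integrable_mult_indicator) auto
  have "0 < 1 / (1 + (2 * pi)\<^sup>2)" by (simp add: add_pos_nonneg)
  also have "\<dots> = (LINT x:{0..1::real}|lborel. 1 / (1 + (2 * pi)\<^sup>2))" by (simp add: set_lebesgue_integral_def)
  also have "\<dots> \<le> (LINT x:{0..1}|lborel. 1 / (1 + (2 * pi * x)\<^sup>2))"
  proof (rule set_integral_mono)
    show "set_integrable lborel {0..1::real} (\<lambda>x. 1 / (1 + (2 * pi)\<^sup>2))"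
      by (intro borel_integrable_atLeastAtMost'  continuous_intros)
    show "set_integrable lborel {0..1} (\<lambda>x. 1 / (1 + (2 * pi * x)\<^sup>2))"
      by (rule set_integrable_subset[OF int']) auto
    fix x :: real assume "x \<in> {0..1}"
    then have "(2 * pi * x)\<^sup>2 \<le> (2 * pi)\<^sup>2" by (intro power_mono) auto
    then show "1 / (1 + (2 * pi)\<^sup>2) \<le> 1 / (1 + (2 * pi * x)\<^sup>2)"
      by (intro divide_left_mono mult_pos_pos) (auto simp: add_pos_nonneg)
  qed
  also have "\<dots> \<le> (LINT x:{0..}|lborel. 1 / (1 + (2 * pi * x)\<^sup>2))"
    unfolding set_lebesgue_integral_def
  proof (rule integral_mono)
    show "integrable lborel (\<lambda>x. indicator {0..1} x *\<^sub>R (1 / (1 + (2 * pi * x)\<^sup>2)))"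
      using set_integrable_subset[OF int', of "{0..1}"] by (simp add: set_integrable_def)
    show "integrable lborel (\<lambda>x. indicator {0..} x *\<^sub>R (1 / (1 + (2 * pi * x)\<^sup>2)))"
      using int' by (simp add: set_integrable_def)
  qed (auto simp: indicator_def)
  finally show ?thesis .
qed

text \<open>Replacing \<open>u\<close> by \<open>- u\<close> swaps the two factors, so the integrand
  is even.\<close>

lemma theta_split:
  assumes "Re z > 0" "d \<ge> 0"
  shows "theta z = 2 * ((LINT u:{0..d}|lborel. bose (z * of_real (exp u)) * bose (z * of_real (exp (- u)))) +
      (LINT u:{d<..}|lborel. bose (z * of_real (exp u)) * bose (z * of_real (exp (- u)))))"
proof -
  define f where "f = (\<lambda>u. bose (z * of_real (exp u)) * bose (z * of_real (exp (- u))))"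
  have int: "integrable lborel f" unfolding f_def by (rule theta_integrable[OF assms(1)])
  have sint: "set_integrable lborel A f" if "A \<in> sets borel" for A
    using int that unfolding set_integrable_def by (intro integrable_mult_indicator) auto
  have "theta z = 2 * (LINT u:{0..}|lborel. f u)"
    using lborel_integral_even[OF int] by (simp add: theta_def f_def mult.commute scaleR_conv_of_real)
  also have "{0..} = {0..d} \<union> {d<..}" using assms(2) by auto
  also have "(LINT u:\<dots>|lborel. f u) = (LINT u:{0..d}|lborel. f u) + (LINT u:{d<..}|lborel. f u)"
    by (intro set_integral_Un sint) auto
  finally show ?thesis by (simp add: f_def)
qed

text \<open>For \<open>y < 1\<close> no pinch occurs, so the tail estimate applies from
  \<open>d = 0\<close> and covers the half-line up to a null set.\<close>

lemma theta_tendsto_zero: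
  fixes s :: "nat \<Rightarrow> real"
  assumes s: "\<And>n. 0 < s n" "\<And>n. s n \<le> 1/20" "s \<longlonglongrightarrow> 0" and y: "0 < y" "y < 1"
  shows "(\<lambda>n. of_real (s n) * theta (Complex (s n) (2 * pi * y))) \<longlonglongrightarrow> 0"
proof -
  have "s n \<le> 1" for n using s(2)[of n] by simp
  then have "(\<lambda>n. of_real (s n) * (LINT u:{0<..}|lborel. bose (Complex (s n) (2 * pi * y) * of_real (exp u)) *
       bose (Complex (s n) (2 * pi * y) * of_real (exp (- u))))) \<longlonglongrightarrow> 0"
    using s y by (intro theta_tail_tendsto[where y = y]) auto
  then have "(\<lambda>n. 2 * (of_real (s n) * (LINT u:{0<..}|lborel. bose (Complex (s n) (2 * pi * y) * of_real (exp u)) *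
       bose (Complex (s n) (2 * pi * y) * of_real (exp (- u)))))) \<longlonglongrightarrow> 2 * 0"
    by (rule tendsto_mult_left)
  moreover have "(LINT u:{0..0}|lborel. f u) = 0" for f :: "real \<Rightarrow> complex"
    unfolding set_lebesgue_integral_def
    by (rule integral_eq_zero_AE, rule eventually_mono[OF AE_lborel_singleton[of 0]]) auto
  ultimately show ?thesis
    using s(1) by (simp add: theta_split[where d = 0] mult.left_commute)
qed

text \<open>The interval \<open>{0..1/100}\<close> contains the pinch and supplies the limit; beyond
  it the tail estimate applies with \<open>d > 0\<close>. The constant is twice a positive integral
  and the same for all sequences \<open>s\<close>.\<close>

lemma theta_tendsto_nonzero:
  obtains c :: complex where "c \<noteq> 0" "\<And>s :: nat \<Rightarrow> real. (\<And>n. 0 < s n) \<Longrightarrow> (\<And>n. s n \<le> 1/20) \<Longrightarrow> s \<longlonglongrightarrow> 0 \<Longrightarrow>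
     (\<lambda>n. of_real (s n) * theta (Complex (s n) (2 * pi))) \<longlonglongrightarrow> c"
proof -
  define I where "I = (LINT x:{0..}|lborel. 1 / (1 + (2 * pi * x)\<^sup>2))"
  have "(\<lambda>n. of_real (s n) * theta (Complex (s n) (2 * pi))) \<longlonglongrightarrow> 2 * (of_real I + 0)"
    if s: "\<And>n. 0 < s n" "\<And>n. s n \<le> 1/20" "s \<longlonglongrightarrow> 0" for s :: "nat \<Rightarrow> real"
  proof -
    have s1: "s n \<le> 1" for n using s(2)[of n] by simp
    have "of_real (s n) * theta (Complex (s n) (2 * pi)) =
       2 * (of_real (s n) * (LINT u:{0..1/100}|lborel. bose (Complex (s n) (2 * pi) * of_real (exp u)) *
         bose (Complex (s n) (2 * pi) * of_real (exp (- u)))) +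
       of_real (s n) * (LINT u:{1/100<..}|lborel. bose (Complex (s n) (2 * pi) * of_real (exp u)) *
         bose (Complex (s n) (2 * pi) * of_real (exp (- u)))))" for n
      using s(1)[of n] by (subst theta_split[where d = "1/100"]) (simp_all add: algebra_simps)
    note eq = this
    show ?thesis
      unfolding eq I_def
      by (intro tendsto_mult_left tendsto_add theta_near_tendsto
          theta_tail_tendsto[where y = 1 and z = "\<lambda>n. Complex (s n) (2 * pi)"] s s1) auto
  qed
  moreover have "2 * (of_real I + 0 :: complex) \<noteq> 0" using integral_inverse_one_plus_square_pos by (simp add: I_def)
  ultimately show ?thesis using that by blast
qed

section \<open>Summation by parts against the kernel\<close>

lemma sqrt_Suc_diff_bounds:
  fixes x :: real
  assumes "x > 0"
  shows "sqrt (x + 1) - sqrt x \<le> 1 / (2 * sqrt x)"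
    and "1 / (2 * sqrt (x + 1)) \<le> sqrt (x + 1) - sqrt x"
proof -
  have eq: "sqrt (x + 1) - sqrt x = 1 / (sqrt (x + 1) + sqrt x)"
  proof -
    have "(sqrt (x + 1) - sqrt x) * (sqrt (x + 1) + sqrt x) = 1"
      using assms by (simp add: algebra_simps)
    moreover have "sqrt (x + 1) + sqrt x > 0" using assms by (simp add: add_pos_pos)
    ultimately show ?thesis by (simp add: field_simps)
  qed
  show "sqrt (x + 1) - sqrt x \<le> 1 / (2 * sqrt x)" "1 / (2 * sqrt (x + 1)) \<le> sqrt (x + 1) - sqrt x"
    unfolding eq using assms by (intro divide_left_mono mult_pos_pos add_pos_pos; simp)+
qed

lemma summation_by_parts:
  fixes a b :: "nat \<Rightarrow> 'a :: comm_ring_1"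
  shows "(\<Sum>i<N. a i * b i) = (\<Sum>i<N. (\<Sum>j<Suc i. a j) * (b i - b (Suc i))) + (\<Sum>j<N. a j) * b N"
  by (induction N) (simp_all add: algebra_simps)

lemma powr_quarter_squared: "(x powr (1/4))\<^sup>2 = sqrt x" if "x \<ge> 0" for x :: real
  using that by (simp add: power2_eq_square powr_half_sqrt flip: powr_add)

text \<open>With \<open>d = 1 / q\<close> both \<open>d\<close> and
  \<open>1 / (d * norm z * sqrt n)\<close> are of order \<open>n^(-1/4)\<close>, and
  \<open>sqrt (n + 1) - sqrt n <= 1 / (2 * q^2)\<close> supplies the rest of \<open>q^-3\<close>.
  This decay makes \<open>n^(1/4)\<close> the critical size for partial sums.\<close>

lemma kern_step_le:
  assumes "0 < x" "x \<le> 1" "n > 0"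
  defines "q \<equiv> real n powr (1/4)"
  shows "norm (kern (Complex x t * of_real (sqrt (real n))) - kern (Complex x t * of_real (sqrt (real (Suc n)))))
           \<le> 4 * (\<bar>t\<bar> + 2) * exp (- 2 * (x * sqrt (real n))) / q ^ 3"
proof -
  define z where "z = Complex x t"
  have q: "q > 0" "q \<ge> 1" "q\<^sup>2 = sqrt (real n)"
    using assms unfolding q_def by (auto simp: ge_one_powr_ge_zero powr_quarter_squared)
  have nz: "norm z > 0" using assms by (simp add: z_def complex_eq_iff)
  have nz_le: "norm z \<le> \<bar>t\<bar> + 1" using cmod_le[of z] assms by (simp add: z_def)
  have "norm (kern (z * of_real (sqrt (real n))) - kern (z * of_real (sqrt (real (Suc n)))))
      \<le> 8 * exp (- 2 * (Re z * sqrt (real n))) * (1 / q + 1 / (1 / q * (norm z * sqrt (real n))))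
         * (norm z * (sqrt (real (Suc n)) - sqrt (real n)))"
    using q assms by (intro norm_kern_diff_le) (auto simp: z_def)
  also have "\<dots> \<le> 8 * exp (- 2 * (Re z * sqrt (real n))) * (1 / q + 1 / (1 / q * (norm z * sqrt (real n))))
         * (norm z * (1 / (2 * sqrt (real n))))"
    using sqrt_Suc_diff_bounds(1)[of "real n"] assms q nz
    by (intro mult_left_mono) (auto simp: add.commute)
  also have "\<dots> = 4 * exp (- 2 * (x * sqrt (real n))) * (norm z + 1) / q ^ 3"
    unfolding q(3)[symmetric] using q nz by (simp add: z_def field_simps power2_eq_square power3_eq_cube)
  also have "\<dots> \<le> 4 * exp (- 2 * (x * sqrt (real n))) * (\<bar>t\<bar> + 2) / q ^ 3"
    using nz_le q by (intro divide_right_mono mult_left_mono) auto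
  finally show ?thesis unfolding z_def by (simp only: mult_ac)
qed

text \<open>Discrete form of the integral of \<open>exp (- 2 * x * sqrt t) / sqrt t\<close> over the
  positive axis, which equals \<open>1 / x\<close>. By \<open>exp y >= 1 + y\<close> each term is at
  most a telescoping difference.\<close>

lemma exp_sqrt_sum_le:
  assumes "x > 0"
  shows "(\<Sum>i<N. exp (- 2 * (x * sqrt (real (Suc i)))) / sqrt (real (Suc i))) \<le> 1 / x"
proof -
  define f where "f = (\<lambda>i. exp (- 2 * (x * sqrt (real i))))"
  have "f (Suc i) / sqrt (real (Suc i)) \<le> (f i - f (Suc i)) / x" for i
  proof -
    have "1 / (2 * sqrt (real (Suc i))) \<le> sqrt (real (Suc i)) - sqrt (real i)"
      using sqrt_Suc_diff_bounds(2)[of "real i"] by (cases "i = 0") (auto simp: add.commute)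
    then have "2 * x * (1 / (2 * sqrt (real (Suc i)))) \<le> 2 * x * (sqrt (real (Suc i)) - sqrt (real i))"
      using assms by (intro mult_left_mono) auto
    also have "\<dots> \<le> exp (2 * x * (sqrt (real (Suc i)) - sqrt (real i))) - 1"
      using exp_ge_add_one_self[of "2 * x * (sqrt (real (Suc i)) - sqrt (real i))"] by linarith
    finally have "f (Suc i) * (2 * x * (1 / (2 * sqrt (real (Suc i)))))
        \<le> f (Suc i) * (exp (2 * x * (sqrt (real (Suc i)) - sqrt (real i))) - 1)"
      by (intro mult_left_mono) (auto simp: f_def)
    also have "f (Suc i) * (exp (2 * x * (sqrt (real (Suc i)) - sqrt (real i))) - 1) = f i - f (Suc i)"
      by (simp add: f_def right_diff_distrib flip: exp_add)
    finally show ?thesis using assms by (simp add: field_simps)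
  qed
  then have "(\<Sum>i<N. f (Suc i) / sqrt (real (Suc i))) \<le> (\<Sum>i<N. (f i - f (Suc i)) / x)"
    by (rule sum_mono)
  also have "\<dots> = (f 0 - f N) / x"
    by (simp add: sum_lessThan_telescope' flip: sum_divide_distrib)
  also have "\<dots> \<le> 1 / x" using assms by (intro divide_right_mono) (auto simp: f_def)
  finally show ?thesis by (simp add: f_def)
qed

text \<open>Summation by parts with partial sums \<open>T\<close>. For \<open>i < N0\<close> the
  kernel differences are at most \<open>A\<close>, which contributes \<open>A * B\<close>
  independently of \<open>x\<close>. Afterwards \<open>e * q\<close> meets
  \<open>A * E / q ^ 3\<close>, and the terms \<open>A * e * E / q^2\<close> sum to at most
  \<open>A * e / x\<close>.\<close>

lemma kern_sum_bound:
  fixes h :: "nat \<Rightarrow> complex"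
  assumes x: "0 < x" "x \<le> 1" and e: "e \<ge> 0"
    and small: "\<And>n. n \<ge> N0 \<Longrightarrow> norm (\<Sum>j<n. h (Suc j)) \<le> e * real n powr (1/4)"
    and L: "(\<lambda>i. h (Suc i) * kern (Complex x t * of_real (sqrt (real (Suc i))))) sums L"
  shows "norm L \<le> 4 * (\<bar>t\<bar> + 2) * ((\<Sum>i<N0. norm (\<Sum>j<Suc i. h (Suc j))) + e / x)"
proof -
  define K where "K = (\<lambda>i. kern (Complex x t * of_real (sqrt (real (Suc i)))))"
  define T where "T = (\<lambda>n. \<Sum>j<n. h (Suc j))"
  define A where "A = 4 * (\<bar>t\<bar> + 2)"
  define B where "B = (\<Sum>i<N0. norm (T (Suc i)))"
  have A: "A \<ge> 0" by (simp add: A_def)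
  have step: "norm (T (Suc i) * (K i - K (Suc i)))
      \<le> A * ((if i < N0 then norm (T (Suc i)) else 0) + e * (exp (- 2 * (x * sqrt (real (Suc i)))) / sqrt (real (Suc i))))"
    for i
  proof -
    define q where "q = real (Suc i) powr (1/4)"
    define E where "E = exp (- 2 * (x * sqrt (real (Suc i))))"
    have q: "q \<ge> 1" "q\<^sup>2 = sqrt (real (Suc i))"
      unfolding q_def by (auto simp: ge_one_powr_ge_zero powr_quarter_squared)
    have E: "0 \<le> E" "E \<le> 1" using x by (auto simp: E_def)
    have K: "norm (K i - K (Suc i)) \<le> A * E / q ^ 3"
      using kern_step_le[OF x, of "Suc i" t] unfolding K_def A_def E_def q_def by simp
    show ?thesis
    proof (cases "i < N0")
      case True
      have "E \<le> q ^ 3" using E q one_le_power[of q 3] by linarith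
      then have "A * E / q ^ 3 \<le> A" using A q by (simp add: divide_le_eq mult_left_mono)
      with K have "norm (T (Suc i) * (K i - K (Suc i))) \<le> norm (T (Suc i)) * A"
        unfolding norm_mult by (intro mult_left_mono) auto
      also have "\<dots> \<le> A * (norm (T (Suc i)) + e * (E / sqrt (real (Suc i))))"
        using A E e by (simp add: algebra_simps)
      finally show ?thesis using True by (simp add: E_def)
    next
      case False
      then have "norm (T (Suc i)) \<le> e * q" unfolding T_def q_def by (intro small) auto
      with K have "norm (T (Suc i) * (K i - K (Suc i))) \<le> (e * q) * (A * E / q ^ 3)"
        unfolding norm_mult using e q by (intro mult_mono) auto
      also have "\<dots> = A * (e * (E / q\<^sup>2))"
        using q by (simp add: power2_eq_square power3_eq_cube field_simps)
      finally show ?thesis using False q by (simp add: E_def)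
    qed
  qed
  have part: "norm (\<Sum>i<N. T (Suc i) * (K i - K (Suc i))) \<le> A * (B + e / x)" for N
  proof -
    have "norm (\<Sum>i<N. T (Suc i) * (K i - K (Suc i)))
       \<le> (\<Sum>i<N. A * ((if i < N0 then norm (T (Suc i)) else 0) + e * (exp (- 2 * (x * sqrt (real (Suc i)))) / sqrt (real (Suc i)))))"
      by (rule sum_norm_le) (use step in auto)
    also have "\<dots> = A * ((\<Sum>i<N. if i < N0 then norm (T (Suc i)) else 0)
        + e * (\<Sum>i<N. exp (- 2 * (x * sqrt (real (Suc i)))) / sqrt (real (Suc i))))"
      by (simp only: sum_distrib_left[symmetric] sum.distrib)
    also have "\<dots> \<le> A * (B + e * (1 / x))"
    proof (intro mult_left_mono add_mono exp_sqrt_sum_le)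
      have "(\<Sum>i<N. if i < N0 then norm (T (Suc i)) else 0) = (\<Sum>i\<in>{..<N} \<inter> {..<N0}. norm (T (Suc i)))"
        by (simp add: sum.If_cases lessThan_def)
      also have "\<dots> \<le> B" unfolding B_def by (intro sum_mono2) auto
      finally show "(\<Sum>i<N. if i < N0 then norm (T (Suc i)) else 0) \<le> B" .
    qed (use x e A in auto)
    finally show ?thesis by simp
  qed
  obtain C where C: "C > 0" "\<And>z n. Re z \<ge> x \<Longrightarrow> n > 0 \<Longrightarrow>
     norm (kern (z * of_real (sqrt (real n)))) \<le> C / (real n)\<^sup>2"
    using kern_sqrt_bound[OF x(1)] by blast
  \<comment> \<open>For fixed \<open>x\<close> the kernel is \<open>O(N^-2)\<close> while
    \<open>T N\<close> is \<open>O(N^(1/4))\<close>, so the boundary term vanishes.\<close>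
  have rest: "(\<lambda>N. T N * K N) \<longlonglongrightarrow> 0"
  proof (rule Lim_null_comparison)
    show "\<forall>\<^sub>F N in sequentially. norm (T N * K N) \<le> e * real N powr (1/4) * (C / (real (Suc N))\<^sup>2)"
      using eventually_ge_at_top[of N0]
    proof eventually_elim
      case (elim N)
      have "norm (K N) \<le> C / (real (Suc N))\<^sup>2" unfolding K_def by (intro C(2)) auto
      moreover have "norm (T N) \<le> e * real N powr (1/4)" unfolding T_def by (intro small elim)
      ultimately show ?case unfolding norm_mult using e by (intro mult_mono) auto
    qed
    show "(\<lambda>N. e * real N powr (1/4) * (C / (real (Suc N))\<^sup>2)) \<longlonglongrightarrow> 0"
      by real_asymp
  qed
  have "(\<lambda>N. \<Sum>i<N. h (Suc i) * K i) \<longlonglongrightarrow> L" using L by (simp add: sums_def K_def)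
  moreover have "(\<Sum>i<N. h (Suc i) * K i) = (\<Sum>i<N. T (Suc i) * (K i - K (Suc i))) + T N * K N" for N
    unfolding T_def by (rule summation_by_parts)
  ultimately have "(\<lambda>N. (\<Sum>i<N. T (Suc i) * (K i - K (Suc i))) + T N * K N) \<longlonglongrightarrow> L"
    by simp
  from tendsto_diff[OF this rest] have "(\<lambda>N. \<Sum>i<N. T (Suc i) * (K i - K (Suc i))) \<longlonglongrightarrow> L" by simp
  then have "norm L \<le> A * (B + e / x)"
    by (rule tendsto_upperbound[OF tendsto_norm]) (use part in auto)
  then show ?thesis by (simp add: A_def B_def T_def)
qed

lemma kern_sum_tendsto_zero:
  fixes h :: "nat \<Rightarrow> complex" and s :: "nat \<Rightarrow> real"
  assumes s: "\<And>n. 0 < s n" "\<And>n. s n \<le> 1" "s \<longlonglongrightarrow> 0"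
    and small: "\<And>e. e > 0 \<Longrightarrow> \<forall>\<^sub>F n in sequentially. norm (\<Sum>j<n. h (Suc j)) \<le> e * real n powr (1/4)"
    and L: "\<And>n. (\<lambda>i. h (Suc i) * kern (Complex (s n) t * of_real (sqrt (real (Suc i))))) sums L n"
  shows "(\<lambda>n. of_real (s n) * L n) \<longlonglongrightarrow> 0"
proof (rule tendsto_norm_zero_cancel, rule order_tendstoI)
  fix r :: real assume "r < 0"
  then show "\<forall>\<^sub>F n in sequentially. r < norm (of_real (s n) * L n)"
    by (intro always_eventually) (auto intro: less_le_trans)
next
  fix r :: real assume r: "0 < r"
  define A where "A = 4 * (\<bar>t\<bar> + 2)"
  \<comment> \<open>Chosen so that \<open>A * e = r / 2\<close>. The resulting \<open>N0\<close> and
    \<open>B\<close> do not depend on \<open>n\<close>, so \<open>s n * (A * B)\<close> tends to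
    0.\<close>
  define e where "e = r / (2 * A)"
  have A: "A > 0" by (simp add: A_def add_nonneg_pos)
  have e: "e > 0" using r A by (simp add: e_def)
  obtain N0 where N0: "\<And>n. n \<ge> N0 \<Longrightarrow> norm (\<Sum>j<n. h (Suc j)) \<le> e * real n powr (1/4)"
    using small[OF e] by (auto simp: eventually_sequentially)
  define B where "B = (\<Sum>i<N0. norm (\<Sum>j<Suc i. h (Suc j)))"
  have bound: "norm (of_real (s n) * L n) \<le> s n * (A * B) + r / 2" for n
  proof -
    have "norm (L n) \<le> A * (B + e / s n)"
      unfolding A_def B_def using e by (intro kern_sum_bound[OF s(1,2) _ N0 L]) auto
    then have "s n * norm (L n) \<le> s n * (A * (B + e / s n))"
      using s(1)[of n] by (intro mult_left_mono) auto
    also have "\<dots> = s n * (A * B) + A * e" using s(1)[of n] by (simp add: algebra_simps)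
    also have "A * e = r / 2" using A by (simp add: e_def)
    finally show ?thesis using s(1)[of n] by (simp add: norm_mult)
  qed
  have "(\<lambda>n. s n * (A * B) + r / 2) \<longlonglongrightarrow> 0 * (A * B) + r / 2"
    by (intro tendsto_intros s)
  then have "\<forall>\<^sub>F n in sequentially. s n * (A * B) + r / 2 < r"
    by (rule order_tendstoD) (use r in auto)
  then show "\<forall>\<^sub>F n in sequentially. norm (of_real (s n) * L n) < r"
    by eventually_elim (use bound in \<open>auto intro: le_less_trans\<close>)
qed

section \<open>The kernel sum of the convolution and the final contradiction\<close>

lemma has_sum_sum:
  assumes "finite A" "\<And>i. i \<in> A \<Longrightarrow> ((f i :: _ \<Rightarrow> 'a :: topological_comm_monoid_add) has_sum s i) B"
  shows "((\<lambda>x. \<Sum>i\<in>A. f i x) has_sum (\<Sum>i\<in>A. s i)) B"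
  using assms by (induction A) (auto intro!: has_sum_add)

text \<open>The admissible pairs are \<open>(d * a, e * b)\<close>; scaling the product by
  \<open>d * e\<close> scales the kernel argument by its square root.\<close>

lemma theta_has_sum_multiples:
  assumes "Re z > 0" "d > 0" "e > 0"
  shows "((\<lambda>(a, b). if d dvd a \<and> e dvd b then kern (z * of_real (sqrt (real (a * b)))) else 0)
           has_sum theta (z * of_real (sqrt (real (d * e))))) ({0<..} \<times> {0<..})"
proof -
  define w where "w = z * of_real (sqrt (real (d * e)))"
  define X where "X = {(a, b). a > 0 \<and> b > 0 \<and> d dvd a \<and> e dvd b}"
  have "((\<lambda>(a, b). kern (w * of_real (sqrt (real (a * b))))) has_sum theta w) ({0<..} \<times> {0<..})"
    using assms by (intro theta_has_sum) (simp add: w_def)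
  also have "?this \<longleftrightarrow> ((\<lambda>(a, b). kern (z * of_real (sqrt (real (a * b))))) has_sum theta w) X"
  proof (rule has_sum_reindex_bij_witness[where j = "\<lambda>(a, b). (d * a, e * b)" and i = "\<lambda>(a, b). (a div d, b div e)"])
    fix x :: "nat \<times> nat" assume "x \<in> {0<..} \<times> {0<..}"
    show "(case case x of (a, b) \<Rightarrow> (d * a, e * b) of (a, b) \<Rightarrow> kern (z * of_real (sqrt (real (a * b)))))
        = (case x of (a, b) \<Rightarrow> kern (w * of_real (sqrt (real (a * b)))))"
      by (cases x) (simp add: w_def real_sqrt_mult mult_ac)
  qed (use assms in \<open>auto simp: X_def elim!: dvdE\<close>)
  also have "\<dots> \<longleftrightarrow> ((\<lambda>(a, b). if d dvd a \<and> e dvd b then kern (z * of_real (sqrt (real (a * b)))) else 0)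
           has_sum theta w) ({0<..} \<times> {0<..})"
    by (rule has_sum_cong_neutral) (auto simp: X_def split: if_splits)
  finally show ?thesis by (simp only: w_def)
qed

text \<open>The divisor expansions turn \<open>f1 a * f2 b\<close> into a finite combination of
  divisibility indicators, each summed by a dilate of \<open>theta\<close>. Grouping the pairs by
  their product recovers the convolution.\<close>

lemma dirichlet_conv_kern_has_sum:
  fixes g1 g2 :: "nat \<Rightarrow> complex"
  assumes z: "Re z > 0" and fin: "finite D1" "finite D2" and pos: "0 \<notin> D1" "0 \<notin> D2"
    and f1: "\<And>n. n > 0 \<Longrightarrow> f1 n = (\<Sum>d\<in>D1. if d dvd n then g1 d else 0)"
    and f2: "\<And>n. n > 0 \<Longrightarrow> f2 n = (\<Sum>d\<in>D2. if d dvd n then g2 d else 0)"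
  shows "((\<lambda>n. dirichlet_conv f1 f2 n * kern (z * of_real (sqrt (real n)))) has_sum
           (\<Sum>d\<in>D1. \<Sum>e\<in>D2. g1 d * g2 e * theta (z * of_real (sqrt (real (d * e)))))) {0<..}"
proof -
  define k where "k = (\<lambda>n::nat. kern (z * of_real (sqrt (real n))))"
  define S where "S = (\<Sum>d\<in>D1. \<Sum>e\<in>D2. g1 d * g2 e * theta (z * of_real (sqrt (real (d * e)))))"
  have "((\<lambda>x. \<Sum>d\<in>D1. \<Sum>e\<in>D2. g1 d * g2 e * (case x of (a, b) \<Rightarrow> if d dvd a \<and> e dvd b then k (a * b) else 0)) has_sum S)
      ({0<..} \<times> {0<..})"
    unfolding S_def k_def
  proof (intro has_sum_sum has_sum_cmult_right theta_has_sum_multiples fin z)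
    show "d > 0" if "d \<in> D1" for d using that pos by (cases d) auto
    show "d > 0" if "d \<in> D2" for d using that pos by (cases d) auto
  qed
  also have "?this \<longleftrightarrow> ((\<lambda>(a, b). f1 a * f2 b * k (a * b)) has_sum S) ({0<..} \<times> {0<..})"
  proof (rule has_sum_cong)
    fix x :: "nat \<times> nat" assume "x \<in> {0<..} \<times> {0<..}"
    then obtain a b where x: "x = (a, b)" "a > 0" "b > 0" by auto
    have "f1 a * f2 b * k (a * b) =
        (\<Sum>d\<in>D1. \<Sum>e\<in>D2. (if d dvd a then g1 d else 0) * (if e dvd b then g2 e else 0) * k (a * b))"
      unfolding f1[OF x(2)] f2[OF x(3)] sum_product by (simp only: sum_distrib_right)
    also have "\<dots> = (\<Sum>d\<in>D1. \<Sum>e\<in>D2. g1 d * g2 e * (if d dvd a \<and> e dvd b then k (a * b) else 0))"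
      by (intro sum.cong refl) auto
    finally show "(\<Sum>d\<in>D1. \<Sum>e\<in>D2. g1 d * g2 e * (case x of (a, b) \<Rightarrow> if d dvd a \<and> e dvd b then k (a * b) else 0))
        = (case x of (a, b) \<Rightarrow> f1 a * f2 b * k (a * b))"
      by (simp add: x)
  qed
  \<comment> \<open>A pair \<open>(a, b)\<close> corresponds to \<open>n = a * b\<close> with the
    marked divisor \<open>d = a\<close>.\<close>
  also have "\<dots> \<longleftrightarrow> ((\<lambda>(n, d). f1 d * f2 (n div d) * k n) has_sum S) (SIGMA n:{0<..}. {d. d dvd n})"
    by (rule has_sum_reindex_bij_witness[where j = "\<lambda>(a, b). (a * b, a)" and i = "\<lambda>(n, d). (d, n div d)"])
       (auto elim!: dvdE)
  finally have "((\<lambda>n. \<Sum>d | d dvd n. f1 d * f2 (n div d) * k n) has_sum S) {0<..}"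
    by (rule has_sum_SigmaD) (auto intro!: has_sum_finiteI)
  then show ?thesis
    by (simp add: dirichlet_conv_def sum_distrib_right S_def k_def)
qed

text \<open>Converts the negated Omega statement into the little-o hypothesis of
  \<open>kern_sum_tendsto_zero\<close>.\<close>

lemma Limsup_nonpos_imp_powr_bound:
  fixes S :: "real \<Rightarrow> complex"
  assumes "\<not> Limsup at_top (\<lambda>x. ereal (x powr (- p) * norm (S x))) > 0" and "e > 0"
  shows "\<forall>\<^sub>F n in sequentially. norm (S (real n)) \<le> e * real n powr p"
proof -
  have "Limsup at_top (\<lambda>x. ereal (x powr (- p) * norm (S x))) < ereal e"
    using assms by (simp add: not_less) (metis ereal_less(2) le_less_trans)
  then have "\<forall>\<^sub>F x in at_top. ereal (x powr (- p) * norm (S x)) < ereal e"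
    by (rule Limsup_lessD)
  then have "\<forall>\<^sub>F n in sequentially. ereal (real n powr (- p) * norm (S (real n))) < ereal e"
    using filterlim_real_sequentially by (rule eventually_compose_filterlim)
  then show ?thesis
    using eventually_gt_at_top[of 0]
  proof eventually_elim
    case (elim n)
    then have "real n powr p > 0" by simp
    with elim show ?case by (simp add: powr_minus field_simps)
  qed
qed

theorem theorem1p1:
  fixes f1 f2 :: "nat \<Rightarrow> complex"
  assumes "multiplicative_fun f1" and "multiplicative_fun f2"
    and "\<exists>M1>0. periodicity_conditions f1 M1"
    and "\<exists>M2>0. periodicity_conditions f2 M2"
  shows "Limsup at_top
           (\<lambda>x::real. ereal (x powr (- (1/4)) *
              norm (\<Sum>n | 1 \<le> n \<and> real n \<le> x. dirichlet_conv f1 f2 n))) > 0"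
proof (rule ccontr)
  assume neg: "\<not> ?thesis"
  define h where "h = dirichlet_conv f1 f2"
  obtain D1 g1 where D1: "finite D1" "D1 \<noteq> {}" "0 \<notin> D1" "\<And>d. d \<in> D1 \<Longrightarrow> g1 d \<noteq> 0"
    "\<And>n. n > 0 \<Longrightarrow> f1 n = (\<Sum>d\<in>D1. if d dvd n then g1 d else 0)"
    using periodic_divisor_expansion[OF assms(1,3)] by metis
  obtain D2 g2 where D2: "finite D2" "D2 \<noteq> {}" "0 \<notin> D2" "\<And>d. d \<in> D2 \<Longrightarrow> g2 d \<noteq> 0"
    "\<And>n. n > 0 \<Longrightarrow> f2 n = (\<Sum>d\<in>D2. if d dvd n then g2 d else 0)"
    using periodic_divisor_expansion[OF assms(2,4)] by metis
  define m1 where "m1 = Max D1"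
  define m2 where "m2 = Max D2"
  have m: "m1 \<in> D1" "m2 \<in> D2" using D1 D2 by (simp_all add: m1_def m2_def)
  have m_pos: "m1 > 0" "m2 > 0" using m D1(3) D2(3) by (metis gr0I)+
  \<comment> \<open>The largest product is attained by exactly one pair, so no other term can cancel
    the singular one.\<close>
  have lt: "d * e < m1 * m2" if "d \<in> D1" "e \<in> D2" "(d, e) \<noteq> (m1, m2)" for d e
  proof -
    have le: "d \<le> m1" "e \<le> m2" using that D1 D2 by (simp_all add: m1_def m2_def)
    show ?thesis
    proof (cases "d = m1")
      case True
      with that(3) le m_pos show ?thesis by simp
    next
      case False
      have "d * e \<le> d * m2" using le by simp
      also have "\<dots> < m1 * m2" using False le m_pos by simp
      finally show ?thesis .
    qed
  qed
  define R where "R = sqrt (real (m1 * m2))"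
  have R: "R > 0" using m_pos by (simp add: R_def)
  have "real (m1 * m2) \<ge> real 1" using m_pos unfolding of_nat_le_iff by (simp add: Suc_le_eq)
  then have R1: "R \<ge> 1" unfolding R_def by simp
  \<comment> \<open>The factor \<open>20 * R\<close> keeps \<open>s n * r <= 1/20\<close> for every
    \<open>r <= R\<close>, as the limits of \<open>theta\<close> require.\<close>
  define s where "s = (\<lambda>n. 1 / (20 * real (Suc n) * R))"
  have s: "s n > 0" "s n \<le> 1" for n
    using R1 mult_mono[of 1 "20 * real (Suc n)" 1 R] by (auto simp: s_def divide_le_eq)
  have s_lim: "s \<longlonglongrightarrow> 0" unfolding s_def using R by real_asymp
  \<comment> \<open>At this height, dilation by \<open>r = sqrt (d * e)\<close> puts the imaginary
    part at \<open>2 * pi * (r / R)\<close>, which reaches the pinch only for the top pair.\<close>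
  define t where "t = 2 * pi / R"
  define L where "L = (\<lambda>n. \<Sum>d\<in>D1. \<Sum>e\<in>D2. g1 d * g2 e * theta (Complex (s n) t * of_real (sqrt (real (d * e)))))"
  have lim0: "(\<lambda>n. of_real (s n) * L n) \<longlonglongrightarrow> 0"
  proof (rule kern_sum_tendsto_zero[OF s s_lim])
    show "(\<lambda>i. h (Suc i) * kern (Complex (s n) t * of_real (sqrt (real (Suc i))))) sums L n" for n
      using dirichlet_conv_kern_has_sum[OF _ D1(1) D2(1) D1(3) D2(3) D1(5) D2(5), of "Complex (s n) t"] s(1)[of n]
      unfolding L_def h_def has_sum_positive_iff_Suc by (intro has_sum_imp_sums) auto
    show "\<forall>\<^sub>F n in sequentially. norm (\<Sum>j<n. h (Suc j)) \<le> e * real n powr (1/4)" if "e > 0" for e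
    proof -
      have "(\<Sum>k | 1 \<le> k \<and> real k \<le> real n. h k) = (\<Sum>j<n. h (Suc j))" for n
        by (rule sum.reindex_bij_witness[of _ Suc "\<lambda>k. k - 1"]) auto
      then show ?thesis
        using Limsup_nonpos_imp_powr_bound[OF neg that] by (simp add: h_def)
    qed
  qed
  obtain c :: complex where c: "c \<noteq> 0" "\<And>s :: nat \<Rightarrow> real. (\<And>n. 0 < s n) \<Longrightarrow> (\<And>n. s n \<le> 1/20) \<Longrightarrow> s \<longlonglongrightarrow> 0 \<Longrightarrow>
     (\<lambda>n. of_real (s n) * theta (Complex (s n) (2 * pi))) \<longlonglongrightarrow> c"
    using theta_tendsto_nonzero by metis
  have lim_term: "(\<lambda>n. of_real (s n) * theta (Complex (s n) t * of_real (sqrt (real (d * e)))))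
      \<longlonglongrightarrow> (if (d, e) = (m1, m2) then c / of_real R else 0)" if de: "d \<in> D1" "e \<in> D2" for d e
  proof -
    define r where "r = sqrt (real (d * e))"
    have "d > 0" "e > 0" using de D1(3) D2(3) by (metis gr0I)+
    then have r: "r > 0" by (simp add: r_def)
    have "d * e \<le> m1 * m2" using lt[OF de] by (cases "(d, e) = (m1, m2)") auto
    then have "r \<le> R" unfolding r_def R_def by (simp only: real_sqrt_le_iff of_nat_le_iff)
    have sr: "s n * r > 0" "s n * r \<le> 1/20" for n
    proof -
      show "s n * r > 0" using s r by simp
      have "s n * r \<le> s n * R" using s(1)[of n] \<open>r \<le> R\<close> by (intro mult_left_mono) auto
      also have "\<dots> = 1 / (20 * real (Suc n))" using R by (simp add: s_def)
      also have "\<dots> \<le> 1/20" by (intro divide_left_mono) auto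
      finally show "s n * r \<le> 1/20" .
    qed
    have sr_lim: "(\<lambda>n. s n * r) \<longlonglongrightarrow> 0" using tendsto_mult_left_zero[OF s_lim] by simp
    \<comment> \<open>The limits of \<open>theta\<close> are scaled by the real part of its own
      argument, here \<open>s n * r\<close>; the factor \<open>1 / r\<close> compensates.\<close>
    have eq: "of_real (s n) * theta (Complex (s n) t * of_real r)
        = 1 / of_real r * (of_real (s n * r) * theta (Complex (s n * r) (2 * pi * (r / R))))" for n
    proof -
      have "Complex (s n) t * of_real r = Complex (s n * r) (2 * pi * (r / R))"
        by (simp add: complex_eq_iff t_def)
      then show ?thesis using r by simp
    qed
    show ?thesis
    proof (cases "(d, e) = (m1, m2)")
      case True
      then have "r = R" by (simp add: r_def R_def)
      have "(\<lambda>n. 1 / of_real r * (of_real (s n * r) * theta (Complex (s n * r) (2 * pi)))) \<longlonglongrightarrow> 1 / of_real r * c"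
        by (intro tendsto_mult_left c(2) sr sr_lim)
      then show ?thesis
        unfolding r_def[symmetric] eq using True \<open>r = R\<close> R by simp
    next
      case False
      then have "d * e < m1 * m2" using lt de by blast
      then have "r < R" unfolding r_def R_def by (simp only: real_sqrt_less_iff of_nat_less_iff)
      then have "(\<lambda>n. 1 / of_real r * (of_real (s n * r) * theta (Complex (s n * r) (2 * pi * (r / R))))) \<longlonglongrightarrow> 1 / of_real r * 0"
        using r R by (intro tendsto_mult_left theta_tendsto_zero sr sr_lim) auto
      then show ?thesis
        unfolding r_def[symmetric] eq if_not_P[OF False] by simp
    qed
  qed
  have L_eq: "of_real (s n) * L n = (\<Sum>d\<in>D1. \<Sum>e\<in>D2. g1 d * g2 e *
      (of_real (s n) * theta (Complex (s n) t * of_real (sqrt (real (d * e))))))" for n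
    by (simp only: L_def sum_distrib_left mult.left_commute)
  have "(\<lambda>n. of_real (s n) * L n) \<longlonglongrightarrow>
      (\<Sum>d\<in>D1. \<Sum>e\<in>D2. g1 d * g2 e * (if (d, e) = (m1, m2) then c / of_real R else 0))"
    unfolding L_eq by (intro tendsto_sum tendsto_mult_left lim_term)
  also have "(\<Sum>d\<in>D1. \<Sum>e\<in>D2. g1 d * g2 e * (if (d, e) = (m1, m2) then c / of_real R else 0))
      = (\<Sum>x\<in>D1 \<times> D2. if x = (m1, m2) then g1 m1 * g2 m2 * (c / of_real R) else 0)"
    unfolding sum.cartesian_product by (intro sum.cong refl) (auto split: if_splits)
  also have "\<dots> = g1 m1 * g2 m2 * (c / of_real R)"
    using m D1(1) D2(1) by (subst sum.delta) auto
  \<comment> \<open>Summation by parts gave the limit 0 for the same sequence, so a product of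
    nonzero factors would have to vanish.\<close>
  finally have "g1 m1 * g2 m2 * (c / of_real R) = 0"
    using lim0 LIMSEQ_unique by blast
  then show False using D1(4)[OF m(1)] D2(4)[OF m(2)] c(1) R by simp
qed

end
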